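(* For all positive integers $a$, $b$, and $n$, the $h^*$-polynomial of $\mathfrak X_n(a,b)$ is real-rooted.
   Context: For $\mathbf b=(b_1,\dots,b_n)\in\mathbb Z_{>0}^n$, a $\mathbf b$-parking function is a list $(\beta_1,\dots,\beta_n)$ of positive integers whose nondecreasing rearrangement $\beta_1'\le\cdots\le\beta_n'$ satisfies $\beta_i'\le b_1+\cdots+b_i$ for all $i$. The polytope $\mathfrak X_n(\mathbf b)\subset\mathbb R^n$ is the convex hull of all $\mathbf b$-parking functions of length $n$, and for positive integers $a,b$, $\mathfrak X_n(a,b):=\mathfrak X_n(a,b,\dots,b)$ (parameter vector of length $n$ with first entry $a$ and all other entries $b$; for $n=1$ it is $\mathfrak X_1(a)$). For a lattice polytope $P\subset\mathbb R^n$ of dimension $d$, $\mathrm{ehr}_P(t)$ is the polynomial in $t$ that equals $\#(tP\cap\mathbb Z^n)$ at every positive integer $t$; writing uniquely $\mathrm{ehr}_P(t)=\sum_{i=0}^d h_i^*\binom{t+d-i}{d}$, the $h^*$-polynomial of $P$ is $h_P^*(z)=h_0^*+h_1^*z+\cdots+h_d^*z^d$. A polynomial is real-rooted if all of its complex roots are real (nonzero constants are vacuously real-rooted). *)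

theory Defs
  imports "HOL-Analysis.Analysis" "HOL-Computational_Algebra.Polynomial" "HOL-Library.Multiset"
begin

text \<open>
  Lists of length n are families indexed by a finite type \<^typ>\<open>'n\<close> with n elements. The index type
  needs no order, because the nondecreasing rearrangement depends only on the multiset of values.
\<close>

definition nondec_rearrangement :: "('n::finite \<Rightarrow> nat) \<Rightarrow> nat list" where
  "nondec_rearrangement \<beta> = sorted_list_of_multiset (image_mset \<beta> (mset_set UNIV))"

text \<open>Lists are indexed from 0, so the bound on entry k is the sum of the first k + 1 parameters.\<close>

definition parking_function :: "nat list \<Rightarrow> ('n::finite \<Rightarrow> nat) \<Rightarrow> bool" where
  "parking_function bs \<beta> \<longleftrightarrow>
     length bs = CARD('n) \<and> (\<forall>i. \<beta> i > 0) \<and>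
     (\<forall>k < CARD('n). nondec_rearrangement \<beta> ! k \<le> sum_list (take (Suc k) bs))"

definition parking_polytope :: "nat list \<Rightarrow> (real ^ 'n::finite) set" where
  "parking_polytope bs = convex hull {(\<chi> i. real (\<beta> i)) | \<beta>. parking_function bs \<beta>}"

definition parking_polytope_ab :: "nat \<Rightarrow> nat \<Rightarrow> (real ^ 'n::finite) set" where
  "parking_polytope_ab a b = parking_polytope (a # replicate (CARD('n) - 1) b)"

definition lattice_points :: "(real ^ 'n::finite) set \<Rightarrow> (real ^ 'n) set" where
  "lattice_points S = {x \<in> S. \<forall>i. x $ i \<in> \<int>}"

text \<open>
  The next two definitions are meaningful for nonempty lattice polytopes, where the described
  polynomials exist; uniqueness is elementary.
\<close>

definition ehrhart_poly :: "(real ^ 'n::finite) set \<Rightarrow> real poly" where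
  "ehrhart_poly P = (THE p. \<forall>t::nat. t > 0 \<longrightarrow>
     poly p (real t) = real (card (lattice_points ((\<lambda>x. real t *\<^sub>R x) ` P))))"

definition h_star_poly :: "(real ^ 'n::finite) set \<Rightarrow> real poly" where
  "h_star_poly P = (let d = nat (aff_dim P) in
     THE h. degree h \<le> d \<and>
       (\<forall>t::real. poly (ehrhart_poly P) t =
          (\<Sum>i\<le>d. coeff h i * ((t + real d - real i) gchoose d))))"

text \<open>The zero polynomial is not real-rooted in this sense.\<close>

definition real_rooted :: "real poly \<Rightarrow> bool" where
  "real_rooted p \<longleftrightarrow> (\<forall>z::complex. poly (map_poly of_real p) z = 0 \<longrightarrow> z \<in> \<real>)"

end

theory Submission
  imports Defs
begin

text \<open>
  Shifting by the all-ones vector turns the polytope into the polymatroid of all y >= 0 with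
  y(S) <= f(S), where f(S) counts, with multiplicity, the segments and triangles meeting S: a - 1
  segments for every vertex and b triangles for every pair of vertices (a vertex maximizing a linear
  form is found greedily, by Abel summation). So the t-th dilate belongs to a multigraph all of whose
  multiplicities are multiplied by t.

  Let E(V,G) be the number of lattice points for the multigraph G on V. Adding a half-edge at i adds
  t E(V-i,G), and adding an edge ij adds t E(V-j,G/ij) + t(t+1)/2 E(V-i-j,G). With this
  deletion-contraction rule, induction on the number of edges shows that for all but two choices of
  the parameters (where h* = 1) the Ehrhart polynomial is a nonnegative combination of the polynomials
  t^i (1+t)^(n-i). The h*-polynomials of the latter are refined Eulerian polynomials: at a point of
  the upper half plane their arguments increase with i inside a cone of angle less than pi, hence no
  nonnegative combination of them vanishes there.
\<close>


subsection \<open>Refined Eulerian polynomials\<close>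

text \<open>Expansions in t^i (1+t)^(n-i) are taken in the fixed degree n = |V|, and already 1 =
  (1+t) - t has a negative coefficient in degree one. This is the obstacle: an isolated vertex
  contributes such a factor 1, and a lone edge on two vertices contributes (t+1)(t+2)/2 = (1+t)^2 -
  t(1+t)/2. Deleting an edge can create either, so the induction cannot run over all multigraphs. It
  is confined to graphs in which every vertex keeps a witness: a half-edge or an edge to a fixed
  root, where the root itself, if present, has a half-edge (\<open>rooted_star\<close>). When no
  summand can be spared, deletion and contraction are treated together, since E(V,G) + t E(V-j,G) =
  (1+t) E(V-j,G) for an isolated j. For a = 1 there are no half-edges, and all edges at a root are
  required instead (\<open>spanning_star\<close>); this works from three vertices on, and two
  vertices need a doubled edge. The two parameter choices left over are a = n = 1, where the
  polytope is a point, and a = b = 1, n = 2, where it is a unimodular triangle.\<close>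

definition cross :: "complex \<Rightarrow> complex \<Rightarrow> real" where
  "cross u v = Im (cnj u * v)"

text \<open>\<open>cross u v\<close> is |u||v| times the sine of the oriented angle from u to v,
  that is, the determinant of the pair over the reals. For nonzero u, the point z u lies
  counterclockwise of u exactly when Im z > 0.\<close>

lemma cross_add_left: "cross (u + v) w = cross u w + cross v w"
  and cross_add_right: "cross u (v + w) = cross u v + cross u w"
  and cross_swap: "cross v u = - cross u v"
  and cross_mult_mult: "cross (z * u) (z * v) = (cmod z)\<^sup>2 * cross u v"
  and cross_mult_self: "cross u (z * u) = Im z * (cmod u)\<^sup>2"
  and cross_self: "cross u u = 0"
  unfolding cross_def cmod_power2
  by (simp_all add: algebra_simps power2_eq_square)

lemma cross_sum_left: "cross (sum f A) v = (\<Sum>i\<in>A. cross (f i) v)"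
  and cross_sum_right: "cross u (sum f A) = (\<Sum>i\<in>A. cross u (f i))"
  by (simp_all add: cross_def sum_distrib_left sum_distrib_right)

text \<open>For z in the upper half plane this says that the arguments of h 0, ..., h d increase and that
  all of them lie in the cone spanned by h 0 and z h 0.\<close>

definition fan :: "complex \<Rightarrow> nat \<Rightarrow> (nat \<Rightarrow> complex) \<Rightarrow> bool" where
  "fan z d h \<longleftrightarrow> (\<forall>i\<le>d. h i \<noteq> 0) \<and>
     (\<forall>i j. i < j \<and> j \<le> d \<longrightarrow> cross (h i) (h j) \<ge> 0 \<and> cross (h j) (z * h i) \<ge> 0)"

text \<open>Pairing a vanishing combination with h 0 and with z h 0 gives two vanishing sums of
  nonnegative terms. A vector h k of positive weight is then parallel to both h 0 and z h 0, which
  are independent over the reals because Im z > 0; so h k = 0, against \<open>fan\<close>.\<close>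

lemma cone_combination_nonzero:
  assumes z: "Im z > 0" and fan: "fan z d h"
    and c: "\<And>i. i \<le> d \<Longrightarrow> c i \<ge> 0" and pos: "k \<le> d" "c k > 0"
  shows "(\<Sum>i\<le>d. of_real (c i) * h i) \<noteq> 0"
proof
  assume zero: "(\<Sum>i\<le>d. of_real (c i) * h i) = 0"
  have h0: "h 0 \<noteq> 0" using fan by (auto simp: fan_def)
  have scale: "cross u (of_real r * v) = r * cross u v" "cross (of_real r * v) u = r * cross v u"
    for r u v by (simp_all add: cross_def algebra_simps)
  have ge1: "cross (h 0) (h i) \<ge> 0" if "i \<le> d" for i
    using fan that by (cases "i = 0") (auto simp: fan_def cross_self)
  have ge2: "cross (h i) (z * h 0) \<ge> 0" if "i \<le> d" for i
    using fan that z by (cases "i = 0") (auto simp: fan_def cross_mult_self)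
  have "(\<Sum>i\<le>d. c i * cross (h 0) (h i)) = cross (h 0) (\<Sum>i\<le>d. of_real (c i) * h i)"
    by (simp add: cross_sum_right scale)
  then have s1: "(\<Sum>i\<le>d. c i * cross (h 0) (h i)) = 0" by (simp add: zero cross_def)
  have "(\<Sum>i\<le>d. c i * cross (h i) (z * h 0)) = cross (\<Sum>i\<le>d. of_real (c i) * h i) (z * h 0)"
    by (simp add: cross_sum_left scale)
  then have s2: "(\<Sum>i\<le>d. c i * cross (h i) (z * h 0)) = 0" by (simp add: zero cross_def)
  have "c k * cross (h 0) (h k) = 0"
    using s1 pos(1) sum_nonneg_eq_0_iff[of "{..d}" "\<lambda>i. c i * cross (h 0) (h i)"] c ge1 by auto
  then have e1: "cross (h 0) (h k) = 0" using pos by simp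
  have "c k * cross (h k) (z * h 0) = 0"
    using s2 pos(1) sum_nonneg_eq_0_iff[of "{..d}" "\<lambda>i. c i * cross (h i) (z * h 0)"] c ge2 by auto
  then have e2: "cross (h k) (z * h 0) = 0" using pos by simp
  \<comment> \<open>In the coordinate q relative to h 0, being parallel to h 0 makes q real, and
    being parallel to z h 0 then forces Re q * Im z = 0.\<close>
  define q where "q = h k / h 0"
  have hk: "h k = q * h 0" using h0 by (simp add: q_def)
  have "Im q = 0" using e1 h0 by (simp add: hk cross_mult_self)
  moreover have "cross (q * h 0) (z * h 0) = (cmod (h 0))\<^sup>2 * Im (cnj q * z)"
    by (simp add: mult.commute[of _ "h 0"] cross_mult_mult) (simp add: cross_def)
  then have "Im (cnj q * z) = 0" using e2 h0 by (simp add: hk)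
  ultimately have "Re q = 0" using z by simp
  with \<open>Im q = 0\<close> have "q = 0" by (simp add: complex_eq_iff)
  then show False using hk fan pos by (auto simp: fan_def)
qed

text \<open>Passing from index i to j > i replaces the block Y = h i + ... + h (j - 1) by z Y and
  leaves a remainder V alone. The order of the h i places V between Y and z Y in angle, and then V +
  z Y lies counterclockwise of V + Y.\<close>

lemma fan_Suc:
  assumes z: "Im z > 0" and fan: "fan z d h"
  shows "fan z (Suc d) (\<lambda>i. z * (\<Sum>k<i. h k) + (\<Sum>k=i..d. h k))"
proof -
  define X where "X i = (\<Sum>k<i. h k)" for i
  define Z where "Z i = (\<Sum>k=i..d. h k)" for i
  have nz: "h i \<noteq> 0" if "i \<le> d" for i using fan that by (simp add: fan_def)
  have c1: "cross (h i) (h j) \<ge> 0" and c2: "cross (h j) (z * h i) \<ge> 0" if "i < j" "j \<le> d" for i j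
    using fan that by (auto simp: fan_def)
  have S1: "cross (sum h A) (sum h B) \<ge> 0" and S2: "cross (sum h B) (z * sum h A) \<ge> 0"
    if "\<And>i j. i \<in> A \<Longrightarrow> j \<in> B \<Longrightarrow> i < j \<and> j \<le> d" for A B
    using that by (auto simp: cross_sum_left cross_sum_right sum_distrib_left intro!: sum_nonneg c1 c2)
  have pair: "cross (z * X i + Z i) (z * X j + Z j) \<ge> 0 \<and>
      cross (z * X j + Z j) (z * (z * X i + Z i)) \<ge> 0" if ij: "i < j" "j \<le> Suc d" for i j
  proof -
    define Y where "Y = (\<Sum>k=i..<j. h k)"
    define V where "V = z * X i + Z j"
    have "{..<j} = {..<i} \<union> {i..<j}" using ij by auto
    moreover have "sum h ({..<i} \<union> {i..<j}) = X i + Y"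
      unfolding X_def Y_def by (rule sum.union_disjoint) auto
    ultimately have Xj: "X j = X i + Y" by (simp only: X_def)
    have "{i..d} = {i..<j} \<union> {j..d}" using ij by auto
    moreover have "sum h ({i..<j} \<union> {j..d}) = Y + Z j"
      unfolding Z_def Y_def by (rule sum.union_disjoint) auto
    ultimately have Zi: "Z i = Y + Z j" by (simp only: Z_def)
    have gi: "z * X i + Z i = V + Y" and gj: "z * X j + Z j = V + z * Y"
      by (simp_all add: V_def Xj Zi algebra_simps)
    have XY: "cross (X i) Y \<ge> 0" "cross Y (z * X i) \<ge> 0"
      unfolding X_def Y_def using ij by (auto intro!: S1 S2)
    have YZ: "cross Y (Z j) \<ge> 0" "cross (Z j) (z * Y) \<ge> 0"
      unfolding Z_def Y_def using ij by (auto intro!: S1 S2)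
    \<comment> \<open>The part z X i of V is compared with z Y after cancelling z, the part Z j
      directly.\<close>
    have VY: "cross V (z * Y) \<ge> 0"
      using XY(1) YZ(2) by (simp add: V_def cross_add_left cross_mult_mult)
    have YV: "cross Y V \<ge> 0"
      using XY(2) YZ(1) by (simp add: V_def cross_add_right)
    have "cross (V + Y) (V + z * Y) = cross V (z * Y) + cross Y V + Im z * (cmod Y)\<^sup>2"
      by (simp add: cross_add_left cross_add_right cross_self cross_mult_self)
    moreover have "cross (V + z * Y) (z * (V + Y)) =
        Im z * (cmod V)\<^sup>2 + cross V (z * Y) + (cmod z)\<^sup>2 * cross Y V"
      by (simp add: cross_add_left cross_add_right cross_self cross_mult_self cross_mult_mult
          distrib_left)
    ultimately show ?thesis unfolding gi gj using VY YV z by simp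
  qed
  have nonzero: "z * X i + Z i \<noteq> 0" if i: "i \<le> Suc d" for i
  proof (cases "i = 0")
    case True
    have "(\<Sum>k\<le>d. of_real 1 * h k) \<noteq> 0"
      by (rule cone_combination_nonzero[OF z fan, of _ 0]) auto
    then show ?thesis by (simp add: True X_def Z_def atLeast0AtMost)
  next
    case False
    have "(\<Sum>k\<le>d. of_real (of_bool (k < i)) * h k) \<noteq> 0"
      by (rule cone_combination_nonzero[OF z fan, of _ 0]) (use False in auto)
    also have "(\<Sum>k\<le>d. of_real (of_bool (k < i)) * h k) = X i"
      unfolding X_def by (rule sum.mono_neutral_cong_right) (use i in auto)
    finally have X: "X i \<noteq> 0" .
    \<comment> \<open>If z X i were equal to - Z i, then Z i would lie clockwise of X i, against the
      order of the h k.\<close>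
    show ?thesis
    proof
      assume "z * X i + Z i = 0"
      then have "Z i = - (z * X i)" by (simp add: eq_neg_iff_add_eq_0 add.commute)
      then have "cross (X i) (Z i) = - cross (X i) (z * X i)" by (simp add: cross_def)
      also have "\<dots> < 0" using X z by (simp add: cross_mult_self)
      moreover have "cross (X i) (Z i) \<ge> 0" unfolding X_def Z_def by (rule S1) auto
      ultimately show False by simp
    qed
  qed
  show ?thesis using pair nonzero unfolding fan_def X_def Z_def by blast
qed

text \<open>The descent enumerator of the permutations of {0..d} with first entry i. The recursion
  removes the first entry: if k is the relative rank of the second entry, there is a descent, hence
  a factor z, exactly for k < i.\<close>

fun refined_eulerian :: "nat \<Rightarrow> nat \<Rightarrow> real poly" where
  "refined_eulerian 0 i = 1"
| "refined_eulerian (Suc d) i =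
     pCons 0 (\<Sum>k<i. refined_eulerian d k) + (\<Sum>k=i..d. refined_eulerian d k)"

abbreviation complex_poly :: "real poly \<Rightarrow> complex poly" where
  "complex_poly \<equiv> map_poly of_real"

lemma complex_poly_add: "complex_poly (p + q) = complex_poly p + complex_poly q"
  by (rule poly_eqI) (simp add: coeff_map_poly)

lemma complex_poly_sum: "complex_poly (sum f A) = (\<Sum>i\<in>A. complex_poly (f i))"
  by (induction A rule: infinite_finite_induct) (simp_all add: complex_poly_add)

lemma complex_poly_smult: "complex_poly (smult c p) = smult (of_real c) (complex_poly p)"
  by (rule poly_eqI) (simp add: coeff_map_poly)

lemma fan_refined_eulerian:
  assumes "Im z > 0"
  shows "fan z d (\<lambda>i. poly (complex_poly (refined_eulerian d i)) z)"
proof (induction d)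
  case 0
  then show ?case by (simp add: fan_def)
next
  case (Suc d)
  show ?case
    using fan_Suc[OF assms Suc] by (simp add: complex_poly_add complex_poly_sum map_poly_pCons poly_sum)
qed

lemma poly_complex_poly_cnj: "poly (complex_poly p) (cnj z) = cnj (poly (complex_poly p) z)"
  by (induction p) (simp_all add: map_poly_pCons)

text \<open>The cone lemma excludes zeros in the open upper half plane; real coefficients carry this
  to the lower one by conjugation.\<close>

lemma real_rooted_refined_eulerian_combination:
  assumes c: "\<And>i. i \<le> d \<Longrightarrow> c i \<ge> 0" and pos: "k \<le> d" "c k > 0"
  shows "real_rooted (\<Sum>i\<le>d. smult (c i) (refined_eulerian d i))" (is "real_rooted ?p")
proof -
  have upper: "poly (complex_poly ?p) z \<noteq> 0" if "Im z > 0" for z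
    using cone_combination_nonzero[OF that fan_refined_eulerian[OF that, of d], of c k] c pos
    by (simp add: complex_poly_sum complex_poly_smult poly_sum)
  have "z \<in> \<real>" if z: "poly (complex_poly ?p) z = 0" for z
  proof -
    have "\<not> Im z > 0" using upper[of z] z by auto
    moreover have "\<not> Im (cnj z) > 0"
      using upper[of "cnj z"] z by (auto simp: poly_complex_poly_cnj)
    ultimately show ?thesis by (simp add: complex_is_Real_iff)
  qed
  then show ?thesis by (simp add: real_rooted_def)
qed

text \<open>The value at t of the polynomial with h*-vector the coefficients of h.\<close>

definition binomial_expansion :: "nat \<Rightarrow> real poly \<Rightarrow> real \<Rightarrow> real" where
  "binomial_expansion d h t = (\<Sum>i\<le>d. coeff h i * ((t + real d - real i) gchoose d))"

section \<open>From the basis t^i (1+t)^(d-i) to h*-vectors\<close>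

lemma degree_refined_eulerian: "i \<le> d \<Longrightarrow> degree (refined_eulerian d i) \<le> d"
proof (induction d arbitrary: i)
  case (Suc d)
  have "degree (\<Sum>k<i. refined_eulerian d k) \<le> d"
    using Suc by (intro degree_sum_le) auto
  then have "degree (pCons 0 (\<Sum>k<i. refined_eulerian d k)) \<le> Suc d"
    using degree_pCons_le[of 0 "\<Sum>k<i. refined_eulerian d k"] by linarith
  moreover have "degree (\<Sum>k=i..d. refined_eulerian d k) \<le> Suc d"
    using Suc.IH by (intro degree_sum_le) (auto intro: le_SucI)
  ultimately show ?case by (simp add: degree_add_le)
qed auto

lemma binomial_expansion_add:
  "binomial_expansion d (p + q) t = binomial_expansion d p t + binomial_expansion d q t"
  by (simp add: binomial_expansion_def sum.distrib algebra_simps)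

lemma binomial_expansion_smult:
  "binomial_expansion d (smult c p) t = c * binomial_expansion d p t"
  by (simp add: binomial_expansion_def sum_distrib_left algebra_simps)

lemma binomial_expansion_sum:
  "binomial_expansion d (sum f A) t = (\<Sum>i\<in>A. binomial_expansion d (f i) t)"
  by (induction A rule: infinite_finite_induct)
    (simp_all add: binomial_expansion_add binomial_expansion_def[of _ 0])

text \<open>By Pascal's rule the forward difference lowers d by one. The factor z in
  \<open>pCons 0 p\<close> shifts the summation index, so p is evaluated at t and q at t + 1; these
  become the two halves of the recursion for \<open>refined_eulerian\<close>.\<close>

lemma binomial_expansion_difference:
  assumes "degree p \<le> d" "degree q \<le> d"
  shows "binomial_expansion (Suc d) (pCons 0 p + q) (t + 1) - binomial_expansion (Suc d) (pCons 0 p + q) t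
    = binomial_expansion d p t + binomial_expansion d q (t + 1)"
proof -
  have pascal: "((x + 1) gchoose Suc d) - (x gchoose Suc d) = x gchoose d" for x :: real
    by (simp add: gbinomial_Suc_Suc)
  have "binomial_expansion (Suc d) (pCons 0 p + q) (t + 1) - binomial_expansion (Suc d) (pCons 0 p + q) t
    = (\<Sum>i\<le>Suc d. coeff (pCons 0 p + q) i * ((t + 1 + real d - real i) gchoose d))"
    unfolding binomial_expansion_def sum_subtractf[symmetric] right_diff_distrib[symmetric]
    by (intro sum.cong refl) (simp add: pascal[symmetric] algebra_simps)
  also have "\<dots> = (\<Sum>i\<le>Suc d. coeff (pCons 0 p) i * ((t + 1 + real d - real i) gchoose d)) +
      (\<Sum>i\<le>Suc d. coeff q i * ((t + 1 + real d - real i) gchoose d))"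
    by (simp add: sum.distrib algebra_simps)
  also have "(\<Sum>i\<le>Suc d. coeff (pCons 0 p) i * ((t + 1 + real d - real i) gchoose d)) =
      binomial_expansion d p t"
    unfolding binomial_expansion_def by (subst sum.atMost_Suc_shift) (simp add: algebra_simps)
  also have "(\<Sum>i\<le>Suc d. coeff q i * ((t + 1 + real d - real i) gchoose d)) =
      binomial_expansion d q (t + 1)"
    unfolding binomial_expansion_def using assms(2) by (simp add: coeff_eq_0)
  finally show ?thesis .
qed

lemma binomial_expansion_nat:
  "binomial_expansion d h (real k) = (\<Sum>i\<le>d. coeff h i * real ((k + d - i) choose d))"
  unfolding binomial_expansion_def
proof (intro sum.cong refl)
  fix i assume "i \<in> {..d}"
  then have "real k + real d - real i = real (k + d - i)" by (simp add: of_nat_diff)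
  then show "coeff h i * (real k + real d - real i gchoose d) = coeff h i * real (k + d - i choose d)"
    by (simp only: binomial_gbinomial)
qed

text \<open>The values at 0, 1, ..., d form a unitriangular system: at k the binomials with i > k
  vanish and the one with i = k equals 1.\<close>

lemma binomial_expansion_unique:
  assumes "degree p \<le> d" "degree q \<le> d"
    and eq: "\<And>k. binomial_expansion d p (real k) = binomial_expansion d q (real k)"
  shows "p = q"
proof -
  define g where "g = p - q"
  have zero: "binomial_expansion d g (real k) = 0" for k
    using eq[of k] binomial_expansion_add[of d g q "real k"] by (simp add: g_def)
  have deg: "degree g \<le> d" unfolding g_def using assms by (simp add: degree_diff_le)
  have "coeff g k = 0" for k
  proof (induction k rule: less_induct)
    case (less k)
    show ?case
    proof (cases "k \<le> d")
      case True
      have "0 = (\<Sum>i\<le>d. coeff g i * real ((k + d - i) choose d))"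
        using zero[of k] by (simp add: binomial_expansion_nat)
      also have "\<dots> = (\<Sum>i\<in>{k}. coeff g i * real ((k + d - i) choose d))"
      proof (rule sum.mono_neutral_right)
        show "\<forall>i\<in>{..d} - {k}. coeff g i * real (k + d - i choose d) = 0"
        proof
          fix i assume i: "i \<in> {..d} - {k}"
          show "coeff g i * real (k + d - i choose d) = 0"
          proof (cases "i < k")
            case False
            then have "k + d - i < d" using i by auto
            then show ?thesis by (simp add: binomial_eq_0)
          qed (simp add: less)
        qed
      qed (use True in auto)
      finally show ?thesis by simp
    next
      case False
      then show ?thesis using deg by (simp add: coeff_eq_0)
    qed
  qed
  then have "g = 0" by (intro poly_eqI) simp
  then show ?thesis by (simp add: g_def)
qed

text \<open>Since 1 = (1+t) - t, each term t^k (1+t)^(d-k) is the difference of t^k (1+t)^(d+1-k)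
  and t^(k+1) (1+t)^(d-k). The prefix sums in \<open>telescope_lower\<close> collapse in the same
  way.\<close>

lemma telescope_upper:
  fixes t :: real
  assumes "i \<le> Suc d"
  shows "(\<Sum>k=i..d. t ^ k * (1 + t) ^ (d - k)) = t ^ i * (1 + t) ^ (Suc d - i) - t ^ Suc d"
  using assms
proof (induction i rule: inc_induct)
  case base
  then show ?case by simp
next
  case (step i)
  have "{i..d} = insert i {Suc i..d}" using step.hyps by auto
  then have "(\<Sum>k=i..d. t ^ k * (1 + t) ^ (d - k)) =
      t ^ i * (1 + t) ^ (d - i) + (\<Sum>k=Suc i..d. t ^ k * (1 + t) ^ (d - k))" by simp
  also have "\<dots> = t ^ i * (1 + t) ^ (d - i) * (1 + t) - t ^ Suc d"
    unfolding step.IH by (simp add: algebra_simps)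
  also have "t ^ i * (1 + t) ^ (d - i) * (1 + t) = t ^ i * (1 + t) ^ (Suc d - i)"
    using step.hyps by (simp add: Suc_diff_le)
  finally show ?case .
qed

lemma telescope_lower:
  fixes t :: real
  assumes "i \<le> Suc d"
  shows "(\<Sum>k<i. t ^ k * (1 + t) ^ (d - k)) = (1 + t) ^ Suc d - t ^ i * (1 + t) ^ (Suc d - i)"
  using assms
proof (induction i)
  case 0
  then show ?case by simp
next
  case (Suc i)
  have "(\<Sum>k<Suc i. t ^ k * (1 + t) ^ (d - k)) =
      (1 + t) ^ Suc d - t ^ i * (1 + t) ^ (Suc d - i) + t ^ i * (1 + t) ^ (d - i)"
    using Suc by simp
  also have "t ^ i * (1 + t) ^ (Suc d - i) = t ^ i * (1 + t) ^ (d - i) * (1 + t)"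
    using Suc.prems by (simp add: Suc_diff_le)
  finally show ?case by (simp add: algebra_simps)
qed

text \<open>Coefficientwise form of the identity sum_t t^i (1+t)^(d-i) z^t = A(z) / (1-z)^(d+1),
  where A is the refined Eulerian polynomial. Both sides agree at 0, and their forward differences
  in n agree by telescoping.\<close>

lemma binomial_expansion_refined_eulerian:
  assumes "i \<le> d"
  shows "binomial_expansion d (refined_eulerian d i) (real n) = real n ^ i * (1 + real n) ^ (d - i)"
  using assms
proof (induction d arbitrary: i n)
  case 0
  then show ?case by (simp add: binomial_expansion_def)
next
  case (Suc d)
  define p where "p = (\<Sum>k<i. refined_eulerian d k)"
  define q where "q = (\<Sum>k=i..d. refined_eulerian d k)"
  have pq: "refined_eulerian (Suc d) i = pCons 0 p + q" by (simp add: p_def q_def)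
  have deg: "degree p \<le> d" "degree q \<le> d" unfolding p_def q_def
    using Suc.prems by (auto intro!: degree_sum_le degree_refined_eulerian)
  have P: "binomial_expansion d p (real m) = (\<Sum>k<i. real m ^ k * (1 + real m) ^ (d - k))" for m
    unfolding p_def binomial_expansion_sum using Suc by (intro sum.cong) auto
  have Q: "binomial_expansion d q (real m) = (\<Sum>k=i..d. real m ^ k * (1 + real m) ^ (d - k))" for m
    unfolding q_def binomial_expansion_sum using Suc by (intro sum.cong) auto
  show ?case
  proof (induction n)
    case 0
    \<comment> \<open>At argument 0 only the constant coefficient counts, and the factor z removes
      p.\<close>
    have "binomial_expansion (Suc d) (pCons 0 p + q) (real 0) =
        (\<Sum>j\<le>Suc d. coeff (pCons 0 p + q) j * real ((0 + Suc d - j) choose Suc d))"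
      by (rule binomial_expansion_nat)
    also have "\<dots> = (\<Sum>j\<in>{0}. coeff (pCons 0 p + q) j * real ((0 + Suc d - j) choose Suc d))"
      by (rule sum.mono_neutral_right) (auto simp: binomial_eq_0)
    also have "\<dots> = coeff q 0" by simp
    also have "\<dots> = (\<Sum>j\<in>{0}. coeff q j * real ((0 + d - j) choose d))" by simp
    also have "\<dots> = (\<Sum>j\<le>d. coeff q j * real ((0 + d - j) choose d))"
      by (rule sum.mono_neutral_left) (auto simp: binomial_eq_0)
    also have "\<dots> = binomial_expansion d q (real 0)"
      by (rule binomial_expansion_nat[symmetric])
    also have "\<dots> = 0 ^ i" using telescope_upper[OF Suc.prems, of 0] by (simp add: Q[of 0, simplified])
    finally show ?case by (simp only: pq) simp
  next
    case (Suc n)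
    have "binomial_expansion (Suc d) (pCons 0 p + q) (real (Suc n)) =
       binomial_expansion (Suc d) (pCons 0 p + q) (real n) +
       binomial_expansion d p (real n) + binomial_expansion d q (real (Suc n))"
      using binomial_expansion_difference[OF deg, of "real n"] by (simp add: add.commute)
    also have "\<dots> = real (Suc n) ^ i * (1 + real (Suc n)) ^ (Suc d - i)"
      unfolding P Q telescope_upper[OF \<open>i \<le> Suc d\<close>] telescope_lower[OF \<open>i \<le> Suc d\<close>]
      using Suc by (simp only: pq) simp
    finally show ?case by (simp only: pq)
  qed
qed

section \<open>Recognising Ehrhart and h*-polynomials from lattice-point counts\<close>

lemma poly_gchoose_exists: "\<exists>p. \<forall>t. poly p t = (t + c) gchoose k" for c :: real
  by (rule exI[of _ "smult (1 / fact k) (\<Prod>i<k. [:c - real i, 1:])"])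
    (simp add: gbinomial_prod_rev poly_prod atLeast0LessThan algebra_simps)

lemma poly_binomial_expansion_exists: "\<exists>p. \<forall>t. poly p t = binomial_expansion d h t"
proof -
  have "\<exists>p. \<forall>t. poly p t = (t + real d - real i) gchoose d" for i
    using poly_gchoose_exists[of "real d - real i" d] by (simp add: algebra_simps)
  then obtain p where "\<And>i t. poly (p i) t = (t + real d - real i) gchoose d" by metis
  then have "\<forall>t. poly (\<Sum>i\<le>d. smult (coeff h i) (p i)) t = binomial_expansion d h t"
    by (simp add: binomial_expansion_def poly_sum)
  then show ?thesis by blast
qed

lemma poly_eq_if_eq_nat:
  fixes p q :: "real poly"
  assumes "\<And>t::nat. t > 0 \<Longrightarrow> poly p (real t) = poly q (real t)"
  shows "p = q"
proof (rule ccontr)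
  assume "p \<noteq> q"
  then have "finite {x. poly (p - q) x = 0}" by (intro poly_roots_finite) simp
  moreover have "real ` {0<..} \<subseteq> {x. poly (p - q) x = 0}" using assms by auto
  ultimately have "finite (real ` {0<..})" by (rule rev_finite_subset)
  then have "finite {0::nat<..}" by (simp add: finite_image_iff)
  then show False by (simp add: infinite_Ioi)
qed

lemma ehrhart_poly_eqI:
  assumes "\<And>t::nat. t > 0 \<Longrightarrow> poly p (real t) = real (card (lattice_points ((\<lambda>x. real t *\<^sub>R x) ` P)))"
  shows "ehrhart_poly P = p"
  unfolding ehrhart_poly_def
  by (rule the_equality) (use assms in \<open>auto intro!: poly_eq_if_eq_nat\<close>)

text \<open>Counts at positive t suffice: they fix the Ehrhart polynomial, and its values at all
  naturals, 0 included, then fix h.\<close>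

lemma h_star_poly_eqI:
  assumes d: "d = nat (aff_dim P)" and deg: "degree h \<le> d"
    and eq: "\<And>t::nat. t > 0 \<Longrightarrow> binomial_expansion d h (real t) = real (card (lattice_points ((\<lambda>x. real t *\<^sub>R x) ` P)))"
  shows "h_star_poly P = h"
proof -
  obtain p where p: "\<And>t. poly p t = binomial_expansion d h t"
    using poly_binomial_expansion_exists by blast
  have E: "ehrhart_poly P = p" by (rule ehrhart_poly_eqI) (simp add: p eq)
  show ?thesis
    unfolding h_star_poly_def Let_def d[symmetric] E p binomial_expansion_def[symmetric]
  proof (rule the_equality)
    fix h' assume h': "degree h' \<le> d \<and> (\<forall>t. binomial_expansion d h t = binomial_expansion d h' t)"
    then show "h' = h" using deg by (intro binomial_expansion_unique[of _ d]) auto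
  qed (use deg in simp)
qed


subsection \<open>Lattice points of polymatroids\<close>

text \<open>Points are functions on the whole type that vanish outside V, so point sets for
  different V share one type and deleting a vertex only shrinks V.\<close>

definition polymatroid_points :: "'a set \<Rightarrow> ('a set \<Rightarrow> nat) \<Rightarrow> ('a \<Rightarrow> nat) set" where
  "polymatroid_points V f = {y. (\<forall>i. i \<notin> V \<longrightarrow> y i = 0) \<and> (\<forall>S\<subseteq>V. sum y S \<le> f S)}"

definition rank_function :: "'a set \<Rightarrow> ('a set \<Rightarrow> nat) \<Rightarrow> bool" where
  "rank_function V f \<longleftrightarrow> (\<forall>S T. S \<subseteq> T \<and> T \<subseteq> V \<longrightarrow> f S \<le> f T) \<and>
     (\<forall>S T. S \<subseteq> V \<and> T \<subseteq> V \<longrightarrow> f (S \<union> T) + f (S \<inter> T) \<le> f S + f T)"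

lemma rank_function_mono: "rank_function V f \<Longrightarrow> S \<subseteq> T \<Longrightarrow> T \<subseteq> V \<Longrightarrow> f S \<le> f T"
  by (simp add: rank_function_def)

lemma polymatroid_points_cong:
  "(\<And>S. S \<subseteq> V \<Longrightarrow> f S = g S) \<Longrightarrow> polymatroid_points V f = polymatroid_points V g"
  by (auto simp: polymatroid_points_def)

lemma finite_polymatroid_points:
  assumes "finite V"
  shows "finite (polymatroid_points V f)"
proof -
  have "polymatroid_points V f \<subseteq> (\<lambda>g i. if i \<in> V then g i else 0) ` (PiE V (\<lambda>i. {..f {i}}))"
  proof
    fix y assume y: "y \<in> polymatroid_points V f"
    then have "sum y {i} \<le> f {i}" if "i \<in> V" for i
      using that unfolding polymatroid_points_def by blast
    then have "restrict y V \<in> PiE V (\<lambda>i. {..f {i}})" by auto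
    moreover have "y = (\<lambda>i. if i \<in> V then restrict y V i else 0)"
      using y by (auto simp: polymatroid_points_def)
    ultimately show "y \<in> (\<lambda>g i. if i \<in> V then g i else 0) ` (PiE V (\<lambda>i. {..f {i}}))" by blast
  qed
  then show ?thesis by (rule finite_subset) (intro finite_imageI finite_PiE; simp add: assms)
qed

lemma polymatroid_points_empty: "polymatroid_points {} f = {\<lambda>_. 0}"
  by (auto simp: polymatroid_points_def)

lemma fun_upd_mem_polymatroid_points:
  assumes V: "finite V" "i \<in> V" and y: "y \<in> polymatroid_points (V - {i}) f"
  shows "y(i := p) \<in> polymatroid_points V f \<longleftrightarrow> (\<forall>S\<subseteq>V - {i}. p + sum y S \<le> f (insert i S))"
proof -
  let ?W = "V - {i}"
  define z where "z = y(i := p)"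
  have fin: "finite S" if "S \<subseteq> ?W" for S using that V finite_subset by blast
  have z: "sum z S = sum y S" "sum z (insert i S) = p + sum y S" if S: "S \<subseteq> ?W" for S
  proof -
    show *: "sum z S = sum y S" by (rule sum.cong) (use S in \<open>auto simp: z_def\<close>)
    have "z i = p" "i \<notin> S" using S by (auto simp: z_def)
    then show "sum z (insert i S) = p + sum y S" using * fin[OF S] by simp
  qed
  have yS: "sum y S \<le> f S" if "S \<subseteq> ?W" for S using y that by (auto simp: polymatroid_points_def)
  have supp: "z k = 0" if "k \<notin> V" for k using y that V by (auto simp: polymatroid_points_def z_def)
  have "z \<in> polymatroid_points V f \<longleftrightarrow> (\<forall>S\<subseteq>V. sum z S \<le> f S)"
    using supp by (auto simp: polymatroid_points_def)
  also have "\<dots> \<longleftrightarrow> (\<forall>S\<subseteq>?W. sum z S \<le> f S \<and> sum z (insert i S) \<le> f (insert i S))" (is "_ \<longleftrightarrow> ?R")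
  proof
    assume R: ?R
    show "\<forall>S\<subseteq>V. sum z S \<le> f S"
    proof (intro allI impI)
      fix S assume S: "S \<subseteq> V"
      then have R': "sum z T \<le> f T \<and> sum z (insert i T) \<le> f (insert i T)" if "T = S - {i}" for T
        using R that by blast
      consider "S = S - {i}" | "S = insert i (S - {i})" by blast
      then show "sum z S \<le> f S" by (cases; use R'[OF refl] in metis)
    qed
  qed (use V in blast)
  finally show ?thesis using z yS by (auto simp: z_def)
qed

lemma polymatroid_points_fun_upd_zero:
  assumes V: "finite V" and y: "y \<in> polymatroid_points V f"
  shows "y(i := 0) \<in> polymatroid_points (V - {i}) f"
proof -
  have "sum (y(i := 0)) S \<le> f S" if "S \<subseteq> V - {i}" for S
  proof -
    have "sum (y(i := 0)) S = sum y S" by (rule sum.cong) (use that in auto)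
    also have "\<dots> \<le> f S" using y that by (auto simp: polymatroid_points_def)
    finally show ?thesis .
  qed
  then show ?thesis using y by (auto simp: polymatroid_points_def)
qed

section \<open>Counting lattice points by fibres over fewer coordinates\<close>

lemma card_polymatroid_points_fibres:
  assumes V: "finite V" "i \<in> V"
  shows "card (polymatroid_points V f) =
    (\<Sum>y\<in>polymatroid_points (V - {i}) f. card {p. y(i := p) \<in> polymatroid_points V f})"
proof -
  let ?S = "SIGMA y:polymatroid_points (V - {i}) f. {p. y(i := p) \<in> polymatroid_points V f}"
  have zero: "y i = 0" if "y \<in> polymatroid_points (V - {i}) f" for y
    using that by (auto simp: polymatroid_points_def)
  have "bij_betw (\<lambda>(y, p). y(i := p)) ?S (polymatroid_points V f)"
    by (rule bij_betw_byWitness[where f' = "\<lambda>y. (y(i := 0), y i)"])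
      (auto simp: zero fun_upd_idem polymatroid_points_fun_upd_zero V)
  moreover have "finite {p. y(i := p) \<in> polymatroid_points V f}" for y
  proof -
    have "inj (\<lambda>p. y(i := p))" by (auto simp: inj_def dest: fun_upd_eqD)
    then have "finite ((\<lambda>p. y(i := p)) -` polymatroid_points V f)"
      by (intro finite_vimageI finite_polymatroid_points V)
    then show ?thesis by (simp add: vimage_def)
  qed
  ultimately show ?thesis
    using V by (simp add: bij_betw_same_card[symmetric] finite_polymatroid_points)
qed

lemma card_polymatroid_points_fibres2:
  assumes V: "finite V" "i \<in> V" "j \<in> V" "i \<noteq> j"
  shows "card (polymatroid_points V f) =
    (\<Sum>y\<in>polymatroid_points (V - {i, j}) f. card {(p, q). y(i := p, j := q) \<in> polymatroid_points V f})"
proof -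
  let ?F = "\<lambda>y. {(p, q). y(i := p, j := q) \<in> polymatroid_points V f}"
  let ?S = "SIGMA y:polymatroid_points (V - {i, j}) f. ?F y"
  have zero: "y i = 0" "y j = 0" if "y \<in> polymatroid_points (V - {i, j}) f" for y
    using that by (auto simp: polymatroid_points_def)
  have del: "y(i := 0, j := 0) \<in> polymatroid_points (V - {i, j}) f"
    if "y \<in> polymatroid_points V f" for y
    using polymatroid_points_fun_upd_zero[of "V - {i}" "y(i := 0)" f j]
      polymatroid_points_fun_upd_zero[of V y f i] that V by (simp add: Diff_insert2[symmetric])
  have "bij_betw (\<lambda>(y, p, q). y(i := p, j := q)) ?S (polymatroid_points V f)"
  proof (rule bij_betw_byWitness[where f' = "\<lambda>y. (y(i := 0, j := 0), y i, y j)"])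
    show "\<forall>a\<in>?S. (\<lambda>y. (y(i := 0, j := 0), y i, y j)) ((\<lambda>(y, p, q). y(i := p, j := q)) a) = a"
      using zero \<open>i \<noteq> j\<close> by (auto simp: fun_eq_iff)
    show "\<forall>y\<in>polymatroid_points V f. (\<lambda>(y, p, q). y(i := p, j := q)) ((\<lambda>y. (y(i := 0, j := 0), y i, y j)) y) = y"
      using \<open>i \<noteq> j\<close> by (auto simp: fun_eq_iff)
    show "(\<lambda>y. (y(i := 0, j := 0), y i, y j)) ` polymatroid_points V f \<subseteq> ?S"
    proof
      fix a assume "a \<in> (\<lambda>y. (y(i := 0, j := 0), y i, y j)) ` polymatroid_points V f"
      then obtain y where y: "y \<in> polymatroid_points V f" "a = (y(i := 0, j := 0), y i, y j)" by blast
      moreover have "y(i := 0, j := 0, i := y i, j := y j) = y" using \<open>i \<noteq> j\<close> by (auto simp: fun_eq_iff)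
      ultimately show "a \<in> ?S" using del by simp
    qed
  qed auto
  moreover have "finite (?F y)" for y
  proof -
    have "inj (\<lambda>(p, q). y(i := p, j := q))"
      using \<open>i \<noteq> j\<close> by (auto simp: inj_def fun_eq_iff split: if_splits)
    then have "finite ((\<lambda>(p, q). y(i := p, j := q)) -` polymatroid_points V f)"
      by (intro finite_vimageI finite_polymatroid_points V)
    moreover have "(\<lambda>(p, q). y(i := p, j := q)) -` polymatroid_points V f = ?F y" by auto
    ultimately show ?thesis by simp
  qed
  ultimately show ?thesis
    using V by (simp add: bij_betw_same_card[symmetric] finite_polymatroid_points)
qed

text \<open>The range of a new coordinate over a fixed y is an interval {0..A}, with A the least
  slack of the constraints. A minimiser S is returned as well, because submodularity will be applied
  to two tight sets.\<close>

lemma minimal_slack: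
  fixes g h :: "'b \<Rightarrow> nat"
  assumes "finite F" "F \<noteq> {}" and le: "\<And>S. S \<in> F \<Longrightarrow> g S \<le> h S"
  obtains A S where "S \<in> F" "A + g S = h S" "\<forall>p. p \<le> A \<longleftrightarrow> (\<forall>S\<in>F. p + g S \<le> h S)"
proof -
  define A where "A = Min ((\<lambda>S. h S - g S) ` F)"
  have "A \<in> (\<lambda>S. h S - g S) ` F" unfolding A_def using assms by (intro Min_in) auto
  then obtain S where S: "S \<in> F" "A = h S - g S" by blast
  have "p \<le> A \<longleftrightarrow> (\<forall>S\<in>F. p + g S \<le> h S)" for p
  proof -
    have "p \<le> A \<longleftrightarrow> (\<forall>S\<in>F. p \<le> h S - g S)" unfolding A_def using assms by simp
    also have "\<dots> \<longleftrightarrow> (\<forall>S\<in>F. p + g S \<le> h S)"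
      by (intro ball_cong refl) (use le in fastforce)
    finally show ?thesis .
  qed
  with S le[of S] show ?thesis using that[of S A] by simp
qed

lemma minimal_slack_Suc:
  fixes g h :: "'b \<Rightarrow> nat"
  assumes "\<And>p. p \<le> A \<longleftrightarrow> (\<forall>S\<in>F. p + g S \<le> h S)"
  shows "p \<le> Suc A \<longleftrightarrow> (\<forall>S\<in>F. p + g S \<le> h S + 1)"
proof (cases p)
  case 0
  have "\<forall>S\<in>F. g S \<le> h S" using assms[of 0] by simp
  then have "\<forall>S\<in>F. g S \<le> Suc (h S)" using le_SucI by blast
  then show ?thesis by (simp add: 0)
next
  case (Suc q)
  then show ?thesis using assms[of q] by simp
qed

text \<open>The old region moved one step in the p-direction fits inside the new one. What remains
  is the column p = 0 with B + 2 points and the row q = B + 1 with p from 1 to C - B, together C + 2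
  points. The condition C \<le> A + B keeps this row inside p \<le> A + 1.\<close>

lemma card_truncated_rectangle_Suc:
  fixes A B C :: nat
  assumes "A \<le> C" "B \<le> C" "C \<le> A + B"
  shows "card {(p, q). p \<le> Suc A \<and> q \<le> Suc B \<and> p + q \<le> Suc C} =
    card {(p, q). p \<le> A \<and> q \<le> B \<and> p + q \<le> C} + (C + 1) + 1"
proof -
  let ?old = "{(p, q). p \<le> A \<and> q \<le> B \<and> p + q \<le> C}"
  let ?shift = "(\<lambda>(p, q). (Suc p, q)) ` ?old"
  let ?left = "Pair (0 :: nat) ` {..Suc B}"
  let ?top = "(\<lambda>p. (p, Suc B)) ` {1..C - B}"
  have fin: "finite ?old" by (rule finite_subset[of _ "{..A} \<times> {..B}"]) auto
  have "{(p, q). p \<le> Suc A \<and> q \<le> Suc B \<and> p + q \<le> Suc C} = ?shift \<union> (?left \<union> ?top)"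
  proof (rule set_eqI)
    fix x :: "nat \<times> nat"
    obtain p q where x: "x = (p, q)" by fastforce
    show "x \<in> {(p, q). p \<le> Suc A \<and> q \<le> Suc B \<and> p + q \<le> Suc C} \<longleftrightarrow> x \<in> ?shift \<union> (?left \<union> ?top)"
      unfolding x using assms by (cases p) (auto simp: image_iff le_Suc_eq)
  qed
  moreover have "card (?shift \<union> (?left \<union> ?top)) = card ?shift + (card ?left + card ?top)"
  proof -
    have "card (?left \<union> ?top) = card ?left + card ?top" by (rule card_Un_disjoint) auto
    moreover have "card (?shift \<union> (?left \<union> ?top)) = card ?shift + card (?left \<union> ?top)"
      by (rule card_Un_disjoint) (use fin in auto)
    ultimately show ?thesis by simp
  qed
  moreover have "card ?shift = card ?old" by (rule card_image) (auto simp: inj_on_def)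
  moreover have "card ?left = Suc (Suc B)" by (subst card_image) (auto simp: inj_on_def)
  moreover have "card ?top = C - B" by (subst card_image) (auto simp: inj_on_def)
  ultimately show ?thesis using assms by simp
qed

text \<open>Over each y the interval of values at i gains one point, and the base of the fibration
  does not see the segment.\<close>

lemma card_polymatroid_points_add_segment:
  assumes V: "finite V" "i \<in> V" and f: "rank_function V f"
  shows "card (polymatroid_points V (\<lambda>S. f S + of_bool (i \<in> S))) =
    card (polymatroid_points V f) + card (polymatroid_points (V - {i}) f)"
proof -
  let ?W = "V - {i}"
  let ?f = "\<lambda>S. f S + of_bool (i \<in> S)"
  have W: "polymatroid_points ?W ?f = polymatroid_points ?W f"
    by (rule polymatroid_points_cong) auto
  have "card {p. y(i := p) \<in> polymatroid_points V ?f} = card {p. y(i := p) \<in> polymatroid_points V f} + 1"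
    if y: "y \<in> polymatroid_points ?W f" for y
  proof -
    have le: "sum y S \<le> f (insert i S)" if "S \<in> Pow ?W" for S
    proof -
      have "sum y S \<le> f S" using y that by (auto simp: polymatroid_points_def)
      also have "\<dots> \<le> f (insert i S)" using that V by (intro rank_function_mono[OF f]) auto
      finally show ?thesis .
    qed
    have fin: "finite (Pow ?W)" "Pow ?W \<noteq> {}" using V by auto
    obtain A where A: "\<forall>p. p \<le> A \<longleftrightarrow> (\<forall>S\<in>Pow ?W. p + sum y S \<le> f (insert i S))"
      by (rule minimal_slack[OF fin, of "sum y" "\<lambda>S. f (insert i S)", OF le]) (assumption, rule that, assumption+)
    have "{p. y(i := p) \<in> polymatroid_points V f} = {..A}"
      using fun_upd_mem_polymatroid_points[OF V y] A by auto
    moreover have "{p. y(i := p) \<in> polymatroid_points V ?f} = {..Suc A}"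
      using fun_upd_mem_polymatroid_points[OF V, of y ?f] y minimal_slack_Suc[OF A[THEN spec]] unfolding W by auto
    ultimately show ?thesis by simp
  qed
  then show ?thesis
    unfolding card_polymatroid_points_fibres[OF V, of f] card_polymatroid_points_fibres[OF V, of ?f] W
    by (simp add: sum.distrib sum_Suc)
qed

text \<open>The vertex j is merged into i, so a set containing i stands for one containing both. On
  points this means keeping only the sum of the two coordinates.\<close>

definition contract :: "'a \<Rightarrow> 'a \<Rightarrow> ('a set \<Rightarrow> nat) \<Rightarrow> 'a set \<Rightarrow> nat" where
  "contract i j f S = f (if i \<in> S then insert j S else S)"

lemma fun_upd2_mem_polymatroid_points:
  assumes V: "finite V" "i \<in> V" "j \<in> V" "i \<noteq> j" and y: "y \<in> polymatroid_points (V - {i, j}) f"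
  shows "y(i := p, j := q) \<in> polymatroid_points V f \<longleftrightarrow>
    (\<forall>S\<in>Pow (V - {i, j}). p + sum y S \<le> f (insert i S)) \<and>
    (\<forall>S\<in>Pow (V - {i, j}). q + sum y S \<le> f (insert j S)) \<and>
    (\<forall>S\<in>Pow (V - {i, j}). p + q + sum y S \<le> f (insert i (insert j S)))"
proof -
  let ?W = "V - {i, j}"
  define z where "z = y(i := p, j := q)"
  have fin: "finite S" if "S \<subseteq> ?W" for S using that V finite_subset by blast
  have z: "sum z S = sum y S" "sum z (insert i S) = p + sum y S" "sum z (insert j S) = q + sum y S"
    "sum z (insert i (insert j S)) = p + q + sum y S" if S: "S \<subseteq> ?W" for S
  proof -
    show *: "sum z S = sum y S" by (rule sum.cong) (use S in \<open>auto simp: z_def\<close>)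
    have "z i = p" "z j = q" "i \<notin> S" "j \<notin> S" using S \<open>i \<noteq> j\<close> by (auto simp: z_def)
    then show "sum z (insert i S) = p + sum y S" "sum z (insert j S) = q + sum y S"
      "sum z (insert i (insert j S)) = p + q + sum y S"
      using * fin[OF S] \<open>i \<noteq> j\<close> by simp_all
  qed
  have yS: "sum y S \<le> f S" if "S \<subseteq> ?W" for S using y that by (auto simp: polymatroid_points_def)
  have supp: "z k = 0" if "k \<notin> V" for k using y that V by (auto simp: polymatroid_points_def z_def)
  have "z \<in> polymatroid_points V f \<longleftrightarrow> (\<forall>S\<subseteq>V. sum z S \<le> f S)"
    using supp by (auto simp: polymatroid_points_def)
  also have "\<dots> \<longleftrightarrow> (\<forall>S\<subseteq>?W. sum z S \<le> f S \<and> sum z (insert i S) \<le> f (insert i S) \<and>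
      sum z (insert j S) \<le> f (insert j S) \<and> sum z (insert i (insert j S)) \<le> f (insert i (insert j S)))"
    (is "_ \<longleftrightarrow> ?R")
  proof
    assume R: ?R
    show "\<forall>S\<subseteq>V. sum z S \<le> f S"
    proof (intro allI impI)
      fix S assume S: "S \<subseteq> V"
      define T where "T = S - {i, j}"
      have T: "T \<subseteq> ?W" using S by (auto simp: T_def)
      have "S = T \<or> S = insert i T \<or> S = insert j T \<or> S = insert i (insert j T)"
        by (cases "i \<in> S"; cases "j \<in> S") (auto simp: T_def)
      then show "sum z S \<le> f S" using R[rule_format, OF T] by (elim disjE) simp_all
    qed
  next
    assume L: "\<forall>S\<subseteq>V. sum z S \<le> f S"
    show ?R
    proof (intro allI impI)
      fix S assume "S \<subseteq> ?W"
      then have "S \<subseteq> V" "insert i S \<subseteq> V" "insert j S \<subseteq> V" "insert i (insert j S) \<subseteq> V"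
        using V by auto
      then show "sum z S \<le> f S \<and> sum z (insert i S) \<le> f (insert i S) \<and>
          sum z (insert j S) \<le> f (insert j S) \<and> sum z (insert i (insert j S)) \<le> f (insert i (insert j S))"
        using L by simp
    qed
  qed
  also have "\<dots> \<longleftrightarrow> (\<forall>S\<in>Pow ?W. p + sum y S \<le> f (insert i S) \<and> q + sum y S \<le> f (insert j S) \<and>
      p + q + sum y S \<le> f (insert i (insert j S)))"
    unfolding Ball_def Pow_iff by (intro all_cong1 imp_cong refl) (simp add: z yS)
  finally show ?thesis unfolding ball_conj_distrib z_def .
qed

text \<open>Over a fixed y the two coordinates range over a rectangle with a corner cut off: p \<le>
  A, q \<le> B, p + q \<le> C. The triangle raises A, B and C by one. Of the C + 2 points gained, C
  + 1 count the fibre of the contraction and the last one counts y itself.\<close>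

lemma card_polymatroid_points_add_triangle:
  assumes V: "finite V" "i \<in> V" "j \<in> V" "i \<noteq> j" and f: "rank_function V f"
  shows "card (polymatroid_points V (\<lambda>S. f S + of_bool (i \<in> S \<or> j \<in> S))) =
    card (polymatroid_points V f) + card (polymatroid_points (V - {j}) (contract i j f)) +
    card (polymatroid_points (V - {i, j}) f)"
proof -
  let ?W = "V - {i, j}"
  let ?f = "\<lambda>S. f S + of_bool (i \<in> S \<or> j \<in> S)"
  let ?c = "contract i j f"
  have W: "polymatroid_points ?W ?f = polymatroid_points ?W f"
    "polymatroid_points ?W ?c = polymatroid_points ?W f"
    by (rule polymatroid_points_cong; auto simp: contract_def)+
  have Wj: "V - {j} - {i} = ?W" by auto
  have mono: "S \<subseteq> T \<Longrightarrow> T \<subseteq> V \<Longrightarrow> f S \<le> f T" for S T using f by (rule rank_function_mono)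
  have "card {(p, q). y(i := p, j := q) \<in> polymatroid_points V ?f} =
      card {(p, q). y(i := p, j := q) \<in> polymatroid_points V f} +
      card {p. y(i := p) \<in> polymatroid_points (V - {j}) ?c} + 1"
    if y: "y \<in> polymatroid_points ?W f" for y
  proof -
    have yS: "sum y S \<le> f S" if "S \<subseteq> ?W" for S using y that by (auto simp: polymatroid_points_def)
    have yT: "sum y S \<le> f T" if "S \<in> Pow ?W" "S \<subseteq> T" "T \<subseteq> V" for S T
      using yS[of S] mono[of S T] that by auto
    have fin: "finite (Pow ?W)" "Pow ?W \<noteq> {}" using V by auto
    have le: "sum y S \<le> f (insert i S)" "sum y S \<le> f (insert j S)"
        "sum y S \<le> f (insert i (insert j S))" if "S \<in> Pow ?W" for S
      using that V by (auto intro!: yT)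
    obtain A S where A: "S \<in> Pow ?W" "A + sum y S = f (insert i S)"
        "\<forall>p. p \<le> A \<longleftrightarrow> (\<forall>S\<in>Pow ?W. p + sum y S \<le> f (insert i S))"
      by (rule minimal_slack[OF fin, of "sum y" "\<lambda>S. f (insert i S)", OF le(1)]) (assumption, rule that, assumption+)
    obtain B T where B: "T \<in> Pow ?W" "B + sum y T = f (insert j T)"
        "\<forall>p. p \<le> B \<longleftrightarrow> (\<forall>S\<in>Pow ?W. p + sum y S \<le> f (insert j S))"
      by (rule minimal_slack[OF fin, of "sum y" "\<lambda>S. f (insert j S)", OF le(2)]) (assumption, rule that, assumption+)
    obtain C where C: "\<forall>p. p \<le> C \<longleftrightarrow> (\<forall>S\<in>Pow ?W. p + sum y S \<le> f (insert i (insert j S)))"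
      by (rule minimal_slack[OF fin, of "sum y" "\<lambda>S. f (insert i (insert j S))", OF le(3)]) (assumption, rule that, assumption+)
    have AC: "A \<le> C"
      unfolding C[THEN spec]
    proof
      fix S assume S: "S \<in> Pow ?W"
      then have "A + sum y S \<le> f (insert i S)" using A(3)[THEN spec, of A] by blast
      also have "\<dots> \<le> f (insert i (insert j S))" using S V by (intro mono) auto
      finally show "A + sum y S \<le> f (insert i (insert j S))" .
    qed
    have BC: "B \<le> C"
      unfolding C[THEN spec]
    proof
      fix S assume S: "S \<in> Pow ?W"
      then have "B + sum y S \<le> f (insert j S)" using B(3)[THEN spec, of B] by blast
      also have "\<dots> \<le> f (insert i (insert j S))" using S V by (intro mono) auto
      finally show "B + sum y S \<le> f (insert i (insert j S))" .
    qed
    \<comment> \<open>Uncrossing: the tight sets \<open>insert i S\<close> and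
      \<open>insert j T\<close> have a union with slack at least C and an intersection with slack at
      least 0, so submodularity gives C \<le> A + B.\<close>
    have "C + sum y (S \<union> T) + sum y (S \<inter> T) \<le> f (insert i (insert j (S \<union> T))) + f (S \<inter> T)"
    proof (rule add_mono)
      have "S \<union> T \<in> Pow ?W" using A(1) B(1) by auto
      then show "C + sum y (S \<union> T) \<le> f (insert i (insert j (S \<union> T)))" using C[THEN spec, of C] by blast
      have "S \<inter> T \<subseteq> ?W" using A(1) by auto
      then show "sum y (S \<inter> T) \<le> f (S \<inter> T)" by (rule yS)
    qed
    also have "\<dots> = f (insert i S \<union> insert j T) + f (insert i S \<inter> insert j T)"
    proof -
      have "i \<notin> T" "j \<notin> S" using A(1) B(1) by auto
      then have "S \<inter> T = insert i S \<inter> insert j T" using V(4) by auto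
      moreover have "insert i (insert j (S \<union> T)) = insert i S \<union> insert j T" by auto
      ultimately show ?thesis by simp
    qed
    also have "\<dots> \<le> f (insert i S) + f (insert j T)"
    proof -
      have "insert i S \<subseteq> V" "insert j T \<subseteq> V" using A(1) B(1) V by auto
      then show ?thesis using f unfolding rank_function_def by blast
    qed
    also have "\<dots> = A + B + (sum y S + sum y T)" using A(2) B(2) by simp
    also have "sum y S + sum y T = sum y (S \<union> T) + sum y (S \<inter> T)"
    proof -
      have "finite S" "finite T" using A(1) B(1) V(1) by (auto intro: finite_subset)
      then show ?thesis by (rule sum.union_inter[symmetric])
    qed
    finally have CAB: "C \<le> A + B" by simp
    have "{(p, q). y(i := p, j := q) \<in> polymatroid_points V f} = {(p, q). p \<le> A \<and> q \<le> B \<and> p + q \<le> C}"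
      unfolding fun_upd2_mem_polymatroid_points[OF V y] A(3)[THEN spec] B(3)[THEN spec] C[THEN spec] ..
    moreover have "{(p, q). y(i := p, j := q) \<in> polymatroid_points V ?f} =
        {(p, q). p \<le> Suc A \<and> q \<le> Suc B \<and> p + q \<le> Suc C}"
      using fun_upd2_mem_polymatroid_points[OF V, of y ?f] y
      unfolding W minimal_slack_Suc[OF A(3)[THEN spec]] minimal_slack_Suc[OF B(3)[THEN spec]] minimal_slack_Suc[OF C[THEN spec]] by simp
    \<comment> \<open>In the contraction the single coordinate at i obeys the bounds that p + q
      obeys here.\<close>
    moreover have "{p. y(i := p) \<in> polymatroid_points (V - {j}) ?c} = {..C}"
      using fun_upd_mem_polymatroid_points[of "V - {j}" i y ?c] V y C
      unfolding Wj W by (auto simp: contract_def insert_commute)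
    ultimately show ?thesis using card_truncated_rectangle_Suc[OF AC BC CAB] by simp
  qed
  moreover have "card (polymatroid_points (V - {j}) ?c) =
      (\<Sum>y\<in>polymatroid_points ?W f. card {p. y(i := p) \<in> polymatroid_points (V - {j}) ?c})"
    using card_polymatroid_points_fibres[of "V - {j}" i ?c] V unfolding Wj W by simp
  ultimately show ?thesis
    unfolding card_polymatroid_points_fibres2[OF V, of f] card_polymatroid_points_fibres2[OF V, of ?f] W
    by (simp add: sum.distrib sum_Suc)
qed


subsection \<open>Deletion-contraction for multigraphs\<close>

lemma rank_function_add:
  assumes f: "rank_function V f" and g: "rank_function V g"
  shows "rank_function V (\<lambda>S. f S + g S)"
  unfolding rank_function_def
proof (intro conjI allI impI)
  fix S T assume "S \<subseteq> T \<and> T \<subseteq> V"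
  then show "f S + g S \<le> f T + g T"
    using f g by (intro add_mono rank_function_mono[of V]) auto
next
  fix S T assume ST: "S \<subseteq> V \<and> T \<subseteq> V"
  have "f (S \<union> T) + f (S \<inter> T) \<le> f S + f T" using f ST by (simp add: rank_function_def)
  moreover have "g (S \<union> T) + g (S \<inter> T) \<le> g S + g T" using g ST by (simp add: rank_function_def)
  ultimately show "f (S \<union> T) + g (S \<union> T) + (f (S \<inter> T) + g (S \<inter> T)) \<le> f S + g S + (f T + g T)"
    by linarith
qed

lemma rank_function_mult: "rank_function V f \<Longrightarrow> rank_function V (\<lambda>S. k * f S)"
  unfolding rank_function_def by (metis distrib_left mult_le_mono2)

lemma rank_function_meets: "rank_function V (\<lambda>S. of_bool (I \<inter> S \<noteq> {}))"
  unfolding rank_function_def by (auto simp: of_bool_def)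

lemma rank_function_contract:
  assumes f: "rank_function V f" and V: "i \<in> V" "j \<in> V"
  shows "rank_function (V - {j}) (contract i j f)"
  unfolding rank_function_def
proof (intro conjI allI impI)
  fix S T assume "S \<subseteq> T \<and> T \<subseteq> V - {j}"
  then show "contract i j f S \<le> contract i j f T"
    unfolding contract_def using V by (intro rank_function_mono[OF f]) auto
next
  fix S T assume ST: "S \<subseteq> V - {j} \<and> T \<subseteq> V - {j}"
  define A where "A = (if i \<in> S then insert j S else S)"
  define B where "B = (if i \<in> T then insert j T else T)"
  have "j \<notin> S" "j \<notin> T" using ST by auto
  then have "(if i \<in> S \<inter> T then insert j (S \<inter> T) else S \<inter> T) = A \<inter> B"
    by (auto simp: A_def B_def)
  moreover have "(if i \<in> S \<union> T then insert j (S \<union> T) else S \<union> T) = A \<union> B"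
    by (auto simp: A_def B_def)
  moreover have "A \<subseteq> V \<and> B \<subseteq> V" using ST V by (auto simp: A_def B_def)
  ultimately show "contract i j f (S \<union> T) + contract i j f (S \<inter> T) \<le> contract i j f S + contract i j f T"
    using f unfolding contract_def A_def[symmetric] B_def[symmetric] rank_function_def by simp
qed

lemma card_polymatroid_points_add_segments:
  assumes V: "finite V" "i \<in> V" and f: "rank_function V f"
  shows "card (polymatroid_points V (\<lambda>S. f S + k * of_bool (i \<in> S))) =
    card (polymatroid_points V f) + k * card (polymatroid_points (V - {i}) f)"
proof (induction k)
  case (Suc k)
  let ?f = "\<lambda>S. f S + k * of_bool (i \<in> S)"
  have "rank_function V ?f"
    using rank_function_add[OF f rank_function_mult[OF rank_function_meets[of V "{i}"], of k]] by simp
  from card_polymatroid_points_add_segment[OF V this]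
  have "card (polymatroid_points V (\<lambda>S. ?f S + of_bool (i \<in> S))) =
    card (polymatroid_points V ?f) + card (polymatroid_points (V - {i}) ?f)" .
  moreover have "polymatroid_points (V - {i}) ?f = polymatroid_points (V - {i}) f"
    by (rule polymatroid_points_cong) auto
  moreover have "(\<lambda>S. ?f S + of_bool (i \<in> S)) = (\<lambda>S. f S + Suc k * of_bool (i \<in> S))"
    by (auto simp: fun_eq_iff)
  ultimately show ?case using Suc by simp
qed simp

text \<open>The factor k (k + 1) / 2 is 1 + 2 + ... + k: when a copy is added to k old ones,
  contraction turns the old ones into k segments at i, each contributing one count over V - {i, j},
  and the new copy contributes one more. The equation is doubled to stay within the
  naturals.\<close>

lemma card_polymatroid_points_add_triangles:
  assumes V: "finite V" "i \<in> V" "j \<in> V" "i \<noteq> j" and f: "rank_function V f"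
  shows "2 * card (polymatroid_points V (\<lambda>S. f S + k * of_bool (i \<in> S \<or> j \<in> S))) =
    2 * card (polymatroid_points V f) + 2 * k * card (polymatroid_points (V - {j}) (contract i j f)) +
    k * (k + 1) * card (polymatroid_points (V - {i, j}) f)"
proof (induction k)
  case (Suc k)
  let ?f = "\<lambda>S. f S + k * of_bool (i \<in> S \<or> j \<in> S)"
  have "rank_function V ?f"
    using rank_function_add[OF f rank_function_mult[OF rank_function_meets[of V "{i, j}"], of k]] by simp
  from card_polymatroid_points_add_triangle[OF V this]
  have "card (polymatroid_points V (\<lambda>S. ?f S + of_bool (i \<in> S \<or> j \<in> S))) =
    card (polymatroid_points V ?f) + card (polymatroid_points (V - {j}) (contract i j ?f)) +
    card (polymatroid_points (V - {i, j}) ?f)" .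
  moreover have "polymatroid_points (V - {i, j}) ?f = polymatroid_points (V - {i, j}) f"
    by (rule polymatroid_points_cong) auto
  moreover have "polymatroid_points (V - {j}) (contract i j ?f) =
      polymatroid_points (V - {j}) (\<lambda>S. contract i j f S + k * of_bool (i \<in> S))"
    by (rule polymatroid_points_cong) (auto simp: contract_def)
  moreover have "card (polymatroid_points (V - {j}) (\<lambda>S. contract i j f S + k * of_bool (i \<in> S))) =
      card (polymatroid_points (V - {j}) (contract i j f)) +
      k * card (polymatroid_points (V - {j} - {i}) (contract i j f))"
    using V f by (intro card_polymatroid_points_add_segments rank_function_contract) auto
  moreover have "polymatroid_points (V - {j} - {i}) (contract i j f) = polymatroid_points (V - {i, j}) f"
    by (subst Diff_insert2[symmetric], subst insert_commute)
      (rule polymatroid_points_cong, auto simp: contract_def)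
  moreover have "(\<lambda>S. ?f S + of_bool (i \<in> S \<or> j \<in> S)) = (\<lambda>S. f S + Suc k * of_bool (i \<in> S \<or> j \<in> S))"
    by (auto simp: fun_eq_iff)
  ultimately show ?case using Suc by (simp add: algebra_simps)
qed simp

text \<open>A multigraph is a multiset G of sets; inside the vertex set V only the traces of these sets
  count: a trace of size two is an edge, a trace of size one is a half-edge (a segment summand).\<close>

definition incidence :: "'a set multiset \<Rightarrow> 'a set \<Rightarrow> nat" where
  "incidence G S = size {#I \<in># G. I \<inter> S \<noteq> {}#}"

definition dilate_count :: "'a set \<Rightarrow> 'a set multiset \<Rightarrow> nat \<Rightarrow> nat" where
  "dilate_count V G t = card (polymatroid_points V (\<lambda>S. t * incidence G S))"

text \<open>Contraction on the level of summands. The vertex j stays in the set because the result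
  is only read inside V - {j}; there an edge i j becomes a half-edge at i.\<close>

definition redirect :: "'a \<Rightarrow> 'a \<Rightarrow> 'a set \<Rightarrow> 'a set" where
  "redirect i j I = (if j \<in> I then insert i I else I)"

lemma incidence_add_mset: "incidence (add_mset I G) S = incidence G S + of_bool (I \<inter> S \<noteq> {})"
  by (simp add: incidence_def)

lemma rank_function_incidence: "rank_function V (incidence G)"
proof (induction G)
  case empty
  then show ?case by (simp add: rank_function_def incidence_def)
next
  case (add I G)
  then show ?case
    using rank_function_add[OF add rank_function_meets[of V I]] by (simp add: incidence_add_mset[abs_def])
qed

lemma incidence_image_redirect:
  assumes "j \<notin> S"
  shows "incidence (image_mset (redirect i j) G) S = contract i j (incidence G) S"
proof (induction G)
  case empty
  then show ?case by (simp add: contract_def incidence_def)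
next
  case (add I G)
  then show ?case using assms by (auto simp: contract_def incidence_add_mset redirect_def)
qed

lemma dilate_count_cong:
  assumes "\<And>S. S \<subseteq> V \<Longrightarrow> incidence G S = incidence H S"
  shows "dilate_count V G t = dilate_count V H t"
  unfolding dilate_count_def
  by (rule arg_cong[of _ _ card], rule polymatroid_points_cong) (simp add: assms)

lemma dilate_count_no_edge:
  assumes "e \<inter> V = {}"
  shows "dilate_count V (add_mset e G) t = dilate_count V G t"
  by (rule dilate_count_cong) (use assms in \<open>auto simp: incidence_add_mset\<close>)

lemma dilate_count_empty: "dilate_count {} G t = 1"
  by (simp add: dilate_count_def polymatroid_points_empty)

lemma dilate_count_half_edge:
  assumes V: "finite V" and e: "e \<inter> V = {i}"
  shows "dilate_count V (add_mset e G) t = dilate_count V G t + t * dilate_count (V - {i}) G t"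
proof -
  have i: "i \<in> V" using e by auto
  have "polymatroid_points V (\<lambda>S. t * incidence (add_mset e G) S) =
      polymatroid_points V (\<lambda>S. t * incidence G S + t * of_bool (i \<in> S))"
  proof (rule polymatroid_points_cong)
    fix S assume "S \<subseteq> V"
    then have "e \<inter> S = (e \<inter> V) \<inter> S" by blast
    then have "e \<inter> S \<noteq> {} \<longleftrightarrow> i \<in> S" unfolding e by auto
    then show "t * incidence (add_mset e G) S = t * incidence G S + t * of_bool (i \<in> S)"
      by (simp add: incidence_add_mset distrib_left)
  qed
  then show ?thesis
    unfolding dilate_count_def
    using card_polymatroid_points_add_segments[OF V i rank_function_mult[OF rank_function_incidence, of V t G]]
    by simp
qed

lemma dilate_count_edge:
  assumes V: "finite V" and e: "e \<inter> V = {i, j}" and ij: "i \<noteq> j"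
  shows "2 * dilate_count V (add_mset e G) t = 2 * dilate_count V G t +
    2 * t * dilate_count (V - {j}) (image_mset (redirect i j) G) t + t * (t + 1) * dilate_count (V - {i, j}) G t"
proof -
  have i: "i \<in> V" "j \<in> V" using e by auto
  have 1: "polymatroid_points V (\<lambda>S. t * incidence (add_mset e G) S) =
      polymatroid_points V (\<lambda>S. t * incidence G S + t * of_bool (i \<in> S \<or> j \<in> S))"
  proof (rule polymatroid_points_cong)
    fix S assume "S \<subseteq> V"
    then have "e \<inter> S = (e \<inter> V) \<inter> S" by blast
    then have "e \<inter> S \<noteq> {} \<longleftrightarrow> i \<in> S \<or> j \<in> S" unfolding e by auto
    then show "t * incidence (add_mset e G) S = t * incidence G S + t * of_bool (i \<in> S \<or> j \<in> S)"
      by (simp add: incidence_add_mset distrib_left)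
  qed
  have 2: "polymatroid_points (V - {j}) (\<lambda>S. t * incidence (image_mset (redirect i j) G) S) =
      polymatroid_points (V - {j}) (contract i j (\<lambda>S. t * incidence G S))"
  proof (rule polymatroid_points_cong)
    fix S assume "S \<subseteq> V - {j}"
    then have "j \<notin> S" by blast
    then show "t * incidence (image_mset (redirect i j) G) S = contract i j (\<lambda>S. t * incidence G S) S"
      by (simp add: incidence_image_redirect contract_def)
  qed
  show ?thesis
    unfolding dilate_count_def 1 2
    by (rule card_polymatroid_points_add_triangles[OF V i ij rank_function_mult[OF rank_function_incidence]])
qed

text \<open>No summand reaches j, so the bound for {j} is 0 and coordinate j vanishes.\<close>

lemma dilate_count_isolated:
  assumes V: "finite V" and j: "\<And>I. I \<in># G \<Longrightarrow> j \<notin> I"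
  shows "dilate_count V G t = dilate_count (V - {j}) G t"
proof -
  let ?f = "\<lambda>S. t * incidence G S"
  have inc: "incidence G (S - {j}) = incidence G S" for S
    using j by (auto simp: incidence_def intro!: arg_cong[of _ _ size] filter_mset_cong)
  have "incidence G {j} = 0" using j by (simp add: incidence_def filter_mset_eq_mempty_iff)
  have "polymatroid_points V ?f = polymatroid_points (V - {j}) ?f"
  proof (intro equalityI subsetI)
    fix y assume y: "y \<in> polymatroid_points V ?f"
    have "y j = 0"
    proof (cases "j \<in> V")
      case True
      then have "sum y {j} \<le> ?f {j}" using y unfolding polymatroid_points_def by blast
      then show ?thesis by (simp add: \<open>incidence G {j} = 0\<close>)
    qed (use y in \<open>auto simp: polymatroid_points_def\<close>)
    then show "y \<in> polymatroid_points (V - {j}) ?f"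
      using polymatroid_points_fun_upd_zero[OF V y, of j] by (simp add: fun_upd_idem)
  next
    fix y assume y: "y \<in> polymatroid_points (V - {j}) ?f"
    then have yj: "y j = 0" by (simp add: polymatroid_points_def)
    have "sum y S \<le> ?f S" if S: "S \<subseteq> V" for S
    proof -
      have "finite S" using S V by (rule finite_subset)
      then have "sum y S = sum y (S - {j})" using yj by (intro sum.mono_neutral_right) auto
      also have "\<dots> \<le> ?f (S - {j})"
      proof -
        have "S - {j} \<subseteq> V - {j}" using S by auto
        then show ?thesis using y unfolding polymatroid_points_def by blast
      qed
      finally show ?thesis by (simp only: inc)
    qed
    then show "y \<in> polymatroid_points V ?f" using y by (auto simp: polymatroid_points_def)
  qed
  then show ?thesis by (simp add: dilate_count_def)
qed

lemma dilate_count_no_edges: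
  assumes "finite V" "\<And>I. I \<in># G \<Longrightarrow> I \<inter> V = {}"
  shows "dilate_count V G t = 1"
  using assms
proof (induction V)
  case empty
  then show ?case by (simp add: dilate_count_empty)
next
  case (insert v V)
  then have "dilate_count (insert v V) G t = dilate_count (insert v V - {v}) G t"
    by (intro dilate_count_isolated) auto
  then show ?case using insert by (simp add: insert.hyps)
qed

lemma dilate_count_single_edge:
  assumes "r \<noteq> k" "e \<inter> {r, k} = {r, k}" "\<And>I. I \<in># G \<Longrightarrow> I \<inter> {r, k} = {}"
  shows "2 * dilate_count {r, k} (add_mset e G) t = (t + 1) * (t + 2)"
proof -
  have "redirect r k I = I" if "I \<in># G" for I using assms(3)[OF that] by (auto simp: redirect_def)
  then have "image_mset (redirect r k) G = G"
    using image_mset_cong[of G "redirect r k" id] by simp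
  moreover have "dilate_count ({r, k} - {k}) G t = 1" "dilate_count {r, k} G t = 1"
    by (rule dilate_count_no_edges; use assms(3) in fastforce)+
  ultimately show ?thesis
    using dilate_count_edge[of "{r, k}" e r k G t] assms by (simp add: dilate_count_empty algebra_simps)
qed

section \<open>The cone spanned by the functions t^i (1+t)^(d-i) and its closure properties\<close>

definition magic_positive :: "nat \<Rightarrow> (nat \<Rightarrow> real) \<Rightarrow> bool" where
  "magic_positive d F \<longleftrightarrow>
     (\<exists>c. (\<forall>i. c i \<ge> 0) \<and> (\<forall>t. F t = (\<Sum>i\<le>d. c i * (real t ^ i * (1 + real t) ^ (d - i)))))"

lemma magic_positive_add:
  assumes "magic_positive d F" "magic_positive d G"
  shows "magic_positive d (\<lambda>t. F t + G t)"
proof -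
  obtain b c where b: "\<forall>i. b i \<ge> 0" "\<forall>t. F t = (\<Sum>i\<le>d. b i * (real t ^ i * (1 + real t) ^ (d - i)))"
    and c: "\<forall>i. c i \<ge> 0" "\<forall>t. G t = (\<Sum>i\<le>d. c i * (real t ^ i * (1 + real t) ^ (d - i)))"
    using assms unfolding magic_positive_def by auto
  show ?thesis unfolding magic_positive_def
    by (rule exI[of _ "\<lambda>i. b i + c i"]) (simp add: b c distrib_right sum.distrib)
qed

lemma magic_positive_cmult:
  assumes "magic_positive d F" "r \<ge> 0"
  shows "magic_positive d (\<lambda>t. r * F t)"
proof -
  obtain c where c: "\<forall>i. c i \<ge> 0" "\<forall>t. F t = (\<Sum>i\<le>d. c i * (real t ^ i * (1 + real t) ^ (d - i)))"
    using assms unfolding magic_positive_def by auto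
  show ?thesis unfolding magic_positive_def
    by (rule exI[of _ "\<lambda>i. r * c i"]) (simp add: c assms sum_distrib_left mult.assoc)
qed

lemma magic_positive_times:
  assumes "magic_positive d F"
  shows "magic_positive (Suc d) (\<lambda>t. real t * F t)"
proof -
  obtain c where c: "\<forall>i. c i \<ge> 0" "\<forall>t. F t = (\<Sum>i\<le>d. c i * (real t ^ i * (1 + real t) ^ (d - i)))"
    using assms unfolding magic_positive_def by auto
  show ?thesis unfolding magic_positive_def
  proof (rule exI[of _ "\<lambda>i. case i of 0 \<Rightarrow> 0 | Suc j \<Rightarrow> c j"], intro conjI allI)
    fix t
    show "real t * F t = (\<Sum>i\<le>Suc d. (case i of 0 \<Rightarrow> 0 | Suc j \<Rightarrow> c j) * (real t ^ i * (1 + real t) ^ (Suc d - i)))"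
      by (subst sum.atMost_Suc_shift) (simp add: c sum_distrib_left algebra_simps)
  qed (simp add: c split: nat.split)
qed

lemma magic_positive_times_Suc:
  assumes "magic_positive d F"
  shows "magic_positive (Suc d) (\<lambda>t. (1 + real t) * F t)"
proof -
  obtain c where c: "\<forall>i. c i \<ge> 0" "\<forall>t. F t = (\<Sum>i\<le>d. c i * (real t ^ i * (1 + real t) ^ (d - i)))"
    using assms unfolding magic_positive_def by auto
  have "(1 + real t) * F t = (\<Sum>i\<le>Suc d. (if i \<le> d then c i else 0) * (real t ^ i * (1 + real t) ^ (Suc d - i)))" for t
    unfolding c(2)[rule_format] sum_distrib_left sum.atMost_Suc
    by (simp, intro sum.cong refl) (simp add: Suc_diff_le)
  then show ?thesis unfolding magic_positive_def using c(1)
    by (intro exI[of _ "\<lambda>i. if i \<le> d then c i else 0"]) auto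
qed

lemma magic_positive_one: "magic_positive 0 (\<lambda>t. 1)"
  unfolding magic_positive_def by (rule exI[of _ "\<lambda>i. 1"]) simp

lemma magic_positive_half_edge:
  assumes V: "finite V" and e: "e \<inter> V = {i}"
    and "magic_positive (card V) (\<lambda>t. real (dilate_count V G t))"
    and "magic_positive (card (V - {i})) (\<lambda>t. real (dilate_count (V - {i}) G t))"
  shows "magic_positive (card V) (\<lambda>t. real (dilate_count V (add_mset e G) t))"
proof -
  have "i \<in> V" using e by auto
  then have "card V = Suc (card (V - {i}))" using V by (metis card_Suc_Diff1)
  then show ?thesis
    unfolding dilate_count_half_edge[OF V e] of_nat_add of_nat_mult
    using assms magic_positive_times magic_positive_add by metis
qed

text \<open>Deletion and contraction enter only through their sum, because the deletion alone can
  fail to be magic positive when it isolates a vertex.\<close>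

lemma magic_positive_edge:
  assumes V: "finite V" and e: "e \<inter> V = {i, j}" and ij: "i \<noteq> j"
    and N: "magic_positive (card V) (\<lambda>t. real (dilate_count V G t) +
      real t * real (dilate_count (V - {j}) (image_mset (redirect i j) G) t))"
    and del: "magic_positive (card (V - {i, j})) (\<lambda>t. real (dilate_count (V - {i, j}) G t))"
  shows "magic_positive (card V) (\<lambda>t. real (dilate_count V (add_mset e G) t))"
proof -
  have "card V = Suc (Suc (card (V - {i, j})))"
  proof -
    have sub: "{i, j} \<subseteq> V" using e by blast
    show ?thesis using card_Diff_subset[OF _ sub] card_mono[OF V sub] ij by simp
  qed
  then have "magic_positive (card V) (\<lambda>t. (1 / 2) * (real t * ((1 + real t) * real (dilate_count (V - {i, j}) G t))))"
    using magic_positive_cmult[OF magic_positive_times[OF magic_positive_times_Suc[OF del]], of "1/2"] by simp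
  from magic_positive_add[OF N this] show ?thesis
  proof (rule back_subst[of "magic_positive (card V)"], intro ext)
    fix t
    have "2 * real (dilate_count V (add_mset e G) t) = 2 * real (dilate_count V G t) +
      2 * real t * real (dilate_count (V - {j}) (image_mset (redirect i j) G) t) +
      real t * (real t + 1) * real (dilate_count (V - {i, j}) G t)"
      using arg_cong[OF dilate_count_edge[OF V e ij, of G t], of real] by (simp add: distrib_left)
    then show "real (dilate_count V G t) + real t * real (dilate_count (V - {j}) (image_mset (redirect i j) G) t) +
      (1 / 2) * (real t * ((1 + real t) * real (dilate_count (V - {i, j}) G t))) =
      real (dilate_count V (add_mset e G) t)" by (simp add: algebra_simps)
  qed
qed

lemma magic_positive_add_times:
  assumes V: "finite V" "j \<in> V"
    and "magic_positive (card V) F" "magic_positive (card (V - {j})) H"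
  shows "magic_positive (card V) (\<lambda>t. F t + real t * H t)"
proof -
  have "card V = Suc (card (V - {j}))" using V by (metis card_Suc_Diff1)
  then show ?thesis using assms magic_positive_times magic_positive_add by metis
qed


subsection \<open>Magic positivity of rooted and spanning stars\<close>

text \<open>The root r need not lie in V: deleting it turns the edges r j into half-edges, so the condition
  passes to all subsets of V.\<close>

definition rooted_star :: "'a \<Rightarrow> 'a set \<Rightarrow> 'a set multiset \<Rightarrow> bool" where
  "rooted_star r V G \<longleftrightarrow> (\<forall>I\<in>#G. card (I \<inter> V) \<le> 2) \<and> (\<forall>j\<in>V. \<exists>I\<in>#G. j \<in> I \<and> I \<inter> V \<subseteq> {r, j})"

lemma card_redirect_le_two:
  assumes "finite V" "i \<in> V" "j \<in> V" "card (I \<inter> V) \<le> 2"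
  shows "card (redirect i j I \<inter> (V - {j})) \<le> 2"
proof (cases "j \<in> I")
  case True
  then have "redirect i j I \<inter> (V - {j}) \<subseteq> insert i (I \<inter> V - {j})" by (auto simp: redirect_def)
  then have "card (redirect i j I \<inter> (V - {j})) \<le> card (insert i (I \<inter> V - {j}))"
    using assms by (intro card_mono) auto
  also have "\<dots> \<le> Suc (card (I \<inter> V - {j}))" by (rule card_insert_le_m1) (simp_all)
  also have "\<dots> = card (I \<inter> V)" using True assms by (intro card_Suc_Diff1) auto
  finally show ?thesis using assms by simp
next
  case False
  then have "card (redirect i j I \<inter> (V - {j})) \<le> card (I \<inter> V)"
    using assms by (intro card_mono) (auto simp: redirect_def)
  then show ?thesis using assms by simp
qed

lemma rooted_star_subset:
  assumes V: "finite V" and R: "rooted_star r V G" and W: "W \<subseteq> V"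
  shows "rooted_star r W G"
  unfolding rooted_star_def
proof (intro conjI ballI)
  fix I assume "I \<in># G"
  then have "card (I \<inter> V) \<le> 2" using R by (simp add: rooted_star_def)
  moreover have "card (I \<inter> W) \<le> card (I \<inter> V)" using V W by (intro card_mono) auto
  ultimately show "card (I \<inter> W) \<le> 2" by simp
next
  fix j assume "j \<in> W"
  then obtain I where "I \<in># G" "j \<in> I" "I \<inter> V \<subseteq> {r, j}" using R W unfolding rooted_star_def by blast
  then show "\<exists>I\<in>#G. j \<in> I \<and> I \<inter> W \<subseteq> {r, j}" using W by blast
qed

text \<open>The witness of a vertex k has its trace inside {r, k}. As j differs from both r and k,
  the witness avoids j and is not redirected.\<close>

lemma rooted_star_redirect:
  assumes V: "finite V" and R: "rooted_star r V G" and ij: "i \<in> V" "j \<in> V" "j \<noteq> r"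
  shows "rooted_star r (V - {j}) (image_mset (redirect i j) G)"
  unfolding rooted_star_def
proof (intro conjI ballI)
  fix I assume "I \<in># image_mset (redirect i j) G"
  then obtain J where "J \<in># G" "I = redirect i j J" by auto
  then show "card (I \<inter> (V - {j})) \<le> 2" using V R ij by (simp add: rooted_star_def card_redirect_le_two)
next
  fix k assume k: "k \<in> V - {j}"
  then obtain I where I: "I \<in># G" "k \<in> I" "I \<inter> V \<subseteq> {r, k}" using R unfolding rooted_star_def by blast
  then have "j \<notin> I" using k ij by blast
  then have "redirect i j I = I" by (simp add: redirect_def)
  then have "I \<in># image_mset (redirect i j) G" using I(1) by (metis imageI set_image_mset)
  then show "\<exists>I\<in>#image_mset (redirect i j) G. k \<in> I \<and> I \<inter> (V - {j}) \<subseteq> {r, k}" using I by blast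
qed

text \<open>The endpoint j that a contraction will remove is chosen different from r, so that the
  root survives.\<close>

lemma trace_cases:
  assumes "finite V" "card (I \<inter> V) \<le> 2"
  obtains "I \<inter> V = {}" | i where "I \<inter> V = {i}" "i \<in> V"
    | i j where "I \<inter> V = {i, j}" "i \<noteq> j" "j \<noteq> r" "i \<in> V" "j \<in> V"
proof -
  consider "card (I \<inter> V) = 0" | "card (I \<inter> V) = 1" | "card (I \<inter> V) = 2" using assms by linarith
  then show thesis
  proof cases
    case 1
    then show thesis using assms that(1) by auto
  next
    case 2
    then obtain i where i: "I \<inter> V = {i}" by (rule card_1_singletonE)
    then show thesis using that(2) by blast
  next
    case 3
    then obtain i j where ij: "I \<inter> V = {i, j}" "i \<noteq> j" by (auto simp: card_2_iff)
    then have V: "i \<in> V" "j \<in> V" by auto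
    show thesis
    proof (cases "j = r")
      case True
      then have "i \<noteq> r" using ij by simp
      moreover have "I \<inter> V = {j, i}" using ij by auto
      ultimately show thesis using that(3)[of j i] ij V by simp
    qed (use that(3)[of i j] ij V in simp)
  qed
qed

lemma redirect_image_mset_absent:
  assumes "\<And>I. I \<in># G \<Longrightarrow> j \<notin> I"
  shows "image_mset (redirect i j) G = G"
proof -
  have "image_mset (redirect i j) G = image_mset id G"
    by (rule image_mset_cong) (simp add: redirect_def assms)
  then show ?thesis by simp
qed

text \<open>As j lies on e alone, contraction does not change G and deletion leaves j isolated. Both
  give the count over V - {j}, with total factor 1 + t.\<close>

lemma magic_positive_pendant:
  assumes V: "finite V" and e: "e \<inter> V = {r, j}" "r \<noteq> j" and G: "\<And>I. I \<in># G \<Longrightarrow> j \<notin> I"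
    and m: "magic_positive (card (V - {j})) (\<lambda>t. real (dilate_count (V - {j}) G t))"
    and m': "magic_positive (card (V - {r, j})) (\<lambda>t. real (dilate_count (V - {r, j}) G t))"
  shows "magic_positive (card V) (\<lambda>t. real (dilate_count V (add_mset e G) t))"
proof (rule magic_positive_edge[OF V e _ m'])
  have "j \<in> V" using e by blast
  then have "card V = Suc (card (V - {j}))" using V by (metis card_Suc_Diff1)
  moreover have "dilate_count V G t = dilate_count (V - {j}) G t" for t
    by (rule dilate_count_isolated[OF V G])
  ultimately show "magic_positive (card V) (\<lambda>t. real (dilate_count V G t) +
      real t * real (dilate_count (V - {j}) (image_mset (redirect r j) G) t))"
    using magic_positive_times_Suc[OF m] by (simp add: redirect_image_mset_absent[OF G] distrib_right)
qed

theorem magic_positive_rooted_star: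
  assumes "finite V" "rooted_star r V G"
  shows "magic_positive (card V) (\<lambda>t. real (dilate_count V G t))"
  using assms
proof (induction "size G" arbitrary: V G rule: less_induct)
  case less
  note V = \<open>finite V\<close> and R = \<open>rooted_star r V G\<close>
  consider "V = {}" | e where "V \<noteq> {}" "e \<in># G" "rooted_star r V (G - {#e#})"
    | "V \<noteq> {}" "\<And>e. e \<in># G \<Longrightarrow> \<not> rooted_star r V (G - {#e#})" by blast
  then show ?case
  proof cases
    case 1
    then show ?thesis by (simp add: dilate_count_empty magic_positive_one)
  next
    case 2
    define H where "H = G - {#e#}"
    have G: "G = add_mset e H" using 2 by (simp add: H_def)
    have H: "rooted_star r V H" using 2 by (simp add: H_def)
    have IH: "magic_positive (card W) (\<lambda>t. real (dilate_count W K t))"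
      if "size K = size H" "finite W" "rooted_star r W K" for W K
      using less.hyps[of K W] that by (simp add: G)
    have "card (e \<inter> V) \<le> 2" using R 2 by (simp add: rooted_star_def)
    then show ?thesis
    proof (cases rule: trace_cases[OF V, where r = r, consumes 1, case_names none half edge])
      case none
      then show ?thesis using IH[OF refl V H] by (simp add: G dilate_count_no_edge)
    next
      case (half i)
      have "finite (V - {i})" using V by simp
      then show ?thesis unfolding G
        by (intro magic_positive_half_edge[OF V half(1)] IH[OF refl V H]
            IH[OF refl _ rooted_star_subset[OF V H]] Diff_subset)
    next
      case (edge i j)
      show ?thesis unfolding G
      proof (rule magic_positive_edge[OF V edge(1,2)])
        show "magic_positive (card V) (\<lambda>t. real (dilate_count V H t) +
            real t * real (dilate_count (V - {j}) (image_mset (redirect i j) H) t))"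
          by (rule magic_positive_add_times[OF V edge(5) IH[OF refl V H]
                IH[OF _ _ rooted_star_redirect[OF V H edge(4,5,3)]]]) (simp_all add: V)
        show "magic_positive (card (V - {i, j})) (\<lambda>t. real (dilate_count (V - {i, j}) H t))"
          by (rule IH[OF refl _ rooted_star_subset[OF V H]]) (use V in auto)
      qed
    qed
  next
    case 3
    text \<open>No summand can be dropped, so every summand is the only one witnessing its vertex; hence a
      vertex j other than the root (or the root itself, if it is alone) lies on a single summand.\<close>
    obtain j where j: "j \<in> V" "j \<noteq> r \<or> V = {r}" using 3 by blast
    have crit: "I \<inter> V \<subseteq> {r, j} \<and> (\<forall>J\<in>#G - {#I#}. \<not> (j \<in> J \<and> J \<inter> V \<subseteq> {r, j}))"
      if I: "I \<in># G" "j \<in> I" for I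
    proof -
      have "\<forall>J\<in>#G - {#I#}. card (J \<inter> V) \<le> 2" using R by (auto simp: rooted_star_def dest: in_diffD)
      then obtain k where k: "k \<in> V" "\<not> (\<exists>J\<in>#G - {#I#}. k \<in> J \<and> J \<inter> V \<subseteq> {r, k})"
        using 3(2)[OF I(1)] unfolding rooted_star_def by blast
      obtain J where J: "J \<in># G" "k \<in> J" "J \<inter> V \<subseteq> {r, k}" using R k(1) unfolding rooted_star_def by blast
      have "J = I"
      proof (rule ccontr)
        assume "J \<noteq> I"
        then have "J \<in># G - {#I#}" using J(1) by (simp add: in_diff_count)
        then show False using k(2) J by blast
      qed
      then have IV: "I \<inter> V \<subseteq> {r, k}" using J by simp
      have "k = j" using IV I(2) j k(1) by auto
      then show ?thesis using IV k(2) by blast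
    qed
    obtain e where e: "e \<in># G" "j \<in> e" "e \<inter> V \<subseteq> {r, j}" using R j unfolding rooted_star_def by blast
    define H where "H = G - {#e#}"
    have G: "G = add_mset e H" using e by (simp add: H_def)
    have jH: "j \<notin> I" if "I \<in># H" for I
      using crit[of I] crit[OF e(1,2)] that unfolding H_def by (meson in_diffD)
    have HV: "\<exists>I\<in>#H. k \<in> I \<and> I \<inter> V \<subseteq> {r, k}" if k: "k \<in> V - {j}" for k
    proof -
      obtain I where I: "I \<in># G" "k \<in> I" "I \<inter> V \<subseteq> {r, k}" using R k unfolding rooted_star_def by blast
      have "I \<noteq> e"
      proof
        assume "I = e"
        then have "j = r" using I e j k by auto
        then show False using j k by auto
      qed
      then have "I \<in># H" using I(1) by (simp add: G)
      then show ?thesis using I by blast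
    qed
    have H: "rooted_star r (V - {j}) H"
      unfolding rooted_star_def
    proof (intro conjI ballI)
      fix I assume "I \<in># H"
      then have "card (I \<inter> V) \<le> 2" using R by (simp add: rooted_star_def G)
      moreover have "I \<inter> (V - {j}) = I \<inter> V" using jH[OF \<open>I \<in># H\<close>] by auto
      ultimately show "card (I \<inter> (V - {j})) \<le> 2" by simp
    next
      fix k assume "k \<in> V - {j}"
      then obtain I where "I \<in># H" "k \<in> I" "I \<inter> V \<subseteq> {r, k}" using HV[of k] by blast
      then show "\<exists>I\<in>#H. k \<in> I \<and> I \<inter> (V - {j}) \<subseteq> {r, k}" by (intro bexI[of _ I]) auto
    qed
    have IH: "magic_positive (card W) (\<lambda>t. real (dilate_count W H t))" if W: "W \<subseteq> V - {j}" for W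
    proof -
      have "finite (V - {j})" using V by simp
      then have "finite W" "rooted_star r W H"
        using W rooted_star_subset[OF _ H W] by (auto intro: finite_subset)
      then show ?thesis by (intro less.hyps) (simp_all add: G)
    qed
    have "e \<inter> V = {j} \<or> (e \<inter> V = {r, j} \<and> r \<noteq> j)" using e j by auto
    then show ?thesis
    proof
      assume ej: "e \<inter> V = {j}"
      \<comment> \<open>Here j is isolated in H, so the half-edge rule yields (1 + t) times the
        count over V - {j}.\<close>
      have "card V = Suc (card (V - {j}))" using V j by (metis card_Suc_Diff1)
      then show ?thesis
        unfolding G dilate_count_half_edge[OF V ej]
        using magic_positive_times_Suc[OF IH[OF subset_refl]] dilate_count_isolated[OF V jH]
        by (simp add: distrib_right)
    next
      assume erj: "e \<inter> V = {r, j} \<and> r \<noteq> j"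
      show ?thesis unfolding G
        by (rule magic_positive_pendant[OF V conjunct1[OF erj] conjunct2[OF erj] jH IH IH]) auto
    qed
  qed
qed

text \<open>A single edge is not magic positive, so the induction stops at two parallel edges, whose
  count (1+t)(1+2t) is computed directly. Further edges and half-edges are handled by
  deletion-contraction.\<close>

lemma magic_positive_two_vertices:
  assumes "r \<noteq> s" "2 \<le> size {#I \<in># G. {r, s} \<subseteq> I#}"
  shows "magic_positive 2 (\<lambda>t. real (dilate_count {r, s} G t))"
  using assms(2)
proof (induction "size G" arbitrary: G rule: less_induct)
  case less
  let ?V = "{r, s}"
  have card2: "card {r, s} = 2" using assms(1) by simp
  have fin: "finite ?V" by simp
  \<comment> \<open>A vertex touched by a summand is a rooted star with itself as root.\<close>
  have rest: "magic_positive (card {k}) (\<lambda>t. real (dilate_count {k} H t))"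
    if "\<exists>I\<in>#H. k \<in> I" for k H
  proof (rule magic_positive_rooted_star)
    have "card (I \<inter> {k}) \<le> 2" for I
      using card_mono[of "{k}" "I \<inter> {k}"] by simp
    then show "rooted_star k {k} H" using that by (auto simp: rooted_star_def)
  qed simp
  have ex: "\<exists>I\<in>#H. {r, s} \<subseteq> I" if H: "1 \<le> size {#I \<in># H. {r, s} \<subseteq> I#}" for H
  proof -
    obtain I where "I \<in># {#I \<in># H. {r, s} \<subseteq> I#}"
      using H by (metis multiset_nonemptyE not_one_le_zero size_empty)
    then show ?thesis by auto
  qed
  have edge: "magic_positive 2 (\<lambda>t. real (dilate_count ?V (add_mset e H) t))"
    if "{r, s} \<subseteq> e" "magic_positive 2 (\<lambda>t. real (dilate_count ?V H t) +
      real t * real (dilate_count {r} (image_mset (redirect r s) H) t))" for e H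
  proof -
    have "e \<inter> ?V = {r, s}" "?V - {s} = {r}" using that assms(1) by auto
    then show ?thesis
      using magic_positive_edge[OF fin, of e r s H] that assms(1)
      by (simp add: dilate_count_empty magic_positive_one card2)
  qed
  show ?case
  proof (cases "\<exists>e\<in>#G. \<not> {r, s} \<subseteq> e")
    case True
    then obtain e where e: "e \<in># G" "\<not> {r, s} \<subseteq> e" by blast
    define H where "H = G - {#e#}"
    have G: "G = add_mset e H" using e by (simp add: H_def)
    have H: "2 \<le> size {#I \<in># H. {r, s} \<subseteq> I#}" using less.prems
      by (simp only: G filter_mset_add_mset e(2) if_False)
    have mH: "magic_positive 2 (\<lambda>t. real (dilate_count ?V H t))" using less.hyps[of H] H by (simp add: G)
    obtain I where I: "I \<in># H" "{r, s} \<subseteq> I" using ex[of H] H by auto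
    consider "e \<inter> ?V = {}" | "e \<inter> ?V = {r}" | "e \<inter> ?V = {s}" using e(2) by auto
    then show ?thesis
    proof cases
      case 1
      then show ?thesis using mH by (simp add: G dilate_count_no_edge)
    next
      case 2
      have "?V - {r} = {s}" using assms(1) by auto
      then have "magic_positive (card (?V - {r})) (\<lambda>t. real (dilate_count (?V - {r}) H t))"
        using rest[of H s] I by auto
      with magic_positive_half_edge[OF fin 2] mH show ?thesis by (simp add: G card2)
    next
      case 3
      have "?V - {s} = {r}" using assms(1) by auto
      then have "magic_positive (card (?V - {s})) (\<lambda>t. real (dilate_count (?V - {s}) H t))"
        using rest[of H r] I by auto
      with magic_positive_half_edge[OF fin 3] mH show ?thesis by (simp add: G card2)
    qed
  next
    case False
    then have all: "{#I \<in># G. {r, s} \<subseteq> I#} = G" by (simp add: filter_mset_eq_conv)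
    then have "G \<noteq> {#}" using less.prems by auto
    then obtain e H where G: "G = add_mset e H" by (metis multiset_cases)
    have e: "{r, s} \<subseteq> e" and H: "\<And>I. I \<in># H \<Longrightarrow> {r, s} \<subseteq> I" using False by (auto simp: G)
    have allH: "{#I \<in># H. {r, s} \<subseteq> I#} = H" using H by (simp add: filter_mset_eq_conv)
    show ?thesis
    proof (cases "2 \<le> size H")
      case True
      then have mH: "magic_positive 2 (\<lambda>t. real (dilate_count ?V H t))"
        using less.hyps[of H] allH by (simp add: G)
      obtain I where "I \<in># H" "{r, s} \<subseteq> I" using ex[of H] allH True by auto
      then have "\<exists>I\<in>#image_mset (redirect r s) H. r \<in> I" by (auto simp: redirect_def)
      then have "magic_positive 1 (\<lambda>t. real (dilate_count {r} (image_mset (redirect r s) H) t))"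
        using rest[of _ r] by simp
      from magic_positive_times[OF this]
      have "magic_positive 2 (\<lambda>t. real t * real (dilate_count {r} (image_mset (redirect r s) H) t))"
        by (simp add: numeral_2_eq_2)
      then show ?thesis unfolding G by (intro edge[OF e] magic_positive_add mH)
    next
      case False
      moreover have "2 \<le> size G" using less.prems by (simp only: all)
      ultimately have "size H = 1" by (simp add: G)
      then obtain f where f: "H = {#f#}" using size_1_singleton_mset by blast
      have rsf: "{r, s} \<subseteq> f" using H by (simp add: f)
      have one: "real (dilate_count ?V H t) = (real t + 1) * (real t + 2) / 2" for t
      proof -
        have "f \<inter> {r, s} = {r, s}" using rsf by auto
        then have "2 * dilate_count ?V H t = (t + 1) * (t + 2)"
          using dilate_count_single_edge[OF assms(1), of f "{#}" t] by (simp add: f)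
        then have "real (2 * dilate_count ?V H t) = real ((t + 1) * (t + 2))" by (rule arg_cong)
        then show ?thesis by (simp add: algebra_simps)
      qed
      have rf: "redirect r s f \<inter> {r} = {r}" using rsf by (auto simp: redirect_def)
      have "dilate_count {r} (image_mset (redirect r s) H) t = 1 + t" for t
        using dilate_count_half_edge[of "{r}" "redirect r s f" r "{#}" t] rf
          dilate_count_no_edges[of "{r}" "{#}" t]
        by (simp add: f dilate_count_empty)
      then have G2: "real (dilate_count ?V G t) = (1 + real t) * (1 + 2 * real t)" for t
      proof -
        have "?V - {s} = {r}" "e \<inter> ?V = {r, s}" using assms(1) e by auto
        then have "2 * dilate_count ?V G t = 2 * dilate_count ?V H t + 2 * t * (1 + t) + t * (t + 1)"
          using dilate_count_edge[OF fin, of e r s H t] assms(1)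
            \<open>dilate_count {r} (image_mset (redirect r s) H) t = 1 + t\<close>
          by (simp add: G dilate_count_empty)
        then have "real (2 * dilate_count ?V G t) = real (2 * dilate_count ?V H t + 2 * t * (1 + t) + t * (t + 1))"
          by (rule arg_cong)
        then have "2 * real (dilate_count ?V G t) =
            2 * real (dilate_count ?V H t) + 2 * real t * (1 + real t) + real t * (real t + 1)"
          by (simp add: algebra_simps)
        then show ?thesis unfolding one by (simp add: field_simps)
      qed
      \<comment> \<open>The factor 1 + 2t is split as (1+t) + t.\<close>
      have "magic_positive (Suc (Suc 0)) (\<lambda>t. (1 + real t) * ((1 + real t) * 1 + real t * 1))"
        by (intro magic_positive_times_Suc magic_positive_add magic_positive_times magic_positive_one)
      then show ?thesis unfolding G2 by (simp add: numeral_2_eq_2 algebra_simps)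
    qed
  qed
qed

text \<open>Unlike in \<open>rooted_star\<close>, the root needs no half-edge; in exchange each
  other vertex must have a full edge to it, and half-edges do not serve as witnesses.\<close>

definition spanning_star :: "'a \<Rightarrow> 'a set \<Rightarrow> 'a set multiset \<Rightarrow> bool" where
  "spanning_star r V G \<longleftrightarrow> r \<in> V \<and> (\<forall>I\<in>#G. card (I \<inter> V) \<le> 2) \<and>
     (\<forall>j\<in>V - {r}. \<exists>I\<in>#G. I \<inter> V = {r, j})"

text \<open>Edges at a missing vertex turn into half-edges: a missing leaf supplies the half-edge at
  the root, and a missing root supplies one at every other vertex.\<close>

lemma rooted_star_of_spanning_star:
  assumes V: "finite V" and S: "spanning_star r V G" and W: "W \<subset> V"
  shows "rooted_star r W G"
  unfolding rooted_star_def
proof (intro conjI ballI)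
  fix I assume "I \<in># G"
  then have "card (I \<inter> V) \<le> 2" using S by (simp add: spanning_star_def)
  moreover have "card (I \<inter> W) \<le> card (I \<inter> V)" using V W by (intro card_mono) auto
  ultimately show "card (I \<inter> W) \<le> 2" by simp
next
  fix k assume k: "k \<in> W"
  show "\<exists>I\<in>#G. k \<in> I \<and> I \<inter> W \<subseteq> {r, k}"
  proof (cases "k = r")
    case True
    obtain i where i: "i \<in> V" "i \<notin> W" using W by blast
    then have "i \<in> V - {r}" using k True by auto
    then obtain I where I: "I \<in># G" "I \<inter> V = {r, i}" using S unfolding spanning_star_def by blast
    have "r \<in> I" "I \<inter> W \<subseteq> {r}" using I(2) i W by auto
    then show ?thesis using I(1) True by auto
  next
    case False
    then have "k \<in> V - {r}" using k W by auto
    then obtain I where "I \<in># G" "I \<inter> V = {r, k}" using S unfolding spanning_star_def by blast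
    then show ?thesis using W by (intro bexI[of _ I]) auto
  qed
qed

theorem magic_positive_spanning_star:
  assumes "finite V" "3 \<le> card V" "spanning_star r V G"
  shows "magic_positive (card V) (\<lambda>t. real (dilate_count V G t))"
  using assms
proof (induction "size G" arbitrary: V G rule: less_induct)
  case less
  note V = \<open>finite V\<close> and S = \<open>spanning_star r V G\<close>
  have r: "r \<in> V" using S by (simp add: spanning_star_def)
  show ?case
  proof (cases "\<exists>e\<in>#G. spanning_star r V (G - {#e#})")
    case True
    then obtain e where e: "e \<in># G" "spanning_star r V (G - {#e#})" by blast
    define H where "H = G - {#e#}"
    have G: "G = add_mset e H" using e by (simp add: H_def)
    have H: "spanning_star r V H" using e by (simp add: H_def)
    have IH: "magic_positive (card W) (\<lambda>t. real (dilate_count W K t))"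
      if "size K = size H" "finite W" "3 \<le> card W" "spanning_star r W K" for W K
      using less.hyps[of K W] that by (simp add: G)
    have mH: "magic_positive (card V) (\<lambda>t. real (dilate_count V H t))"
      using IH V H less.prems by blast
    have del: "magic_positive (card W) (\<lambda>t. real (dilate_count W H t))" if "W \<subset> V" for W
      using that V by (intro magic_positive_rooted_star[of _ r] rooted_star_of_spanning_star[OF V H])
        (auto intro: finite_subset)
    have "card (e \<inter> V) \<le> 2" using S e by (simp add: spanning_star_def)
    then show ?thesis
    proof (cases rule: trace_cases[OF V, where r = r, consumes 1, case_names none half edge])
      case none
      then show ?thesis using mH by (simp add: G dilate_count_no_edge)
    next
      case (half i)
      show ?thesis unfolding G
        by (rule magic_positive_half_edge[OF V half(1) mH del]) (use half in auto)
    next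
      case (edge i j)
      let ?H = "image_mset (redirect i j) H"
      have cardVj: "card V = Suc (card (V - {j}))" using V edge by (metis card_Suc_Diff1)
      have le2: "card (I \<inter> (V - {j})) \<le> 2" if "I \<in># ?H" for I
        using that H edge V by (auto simp: spanning_star_def card_redirect_le_two)
      have wit: "\<exists>I\<in>#?H. I \<inter> (V - {j}) = {r, k}" if k: "k \<in> V - {j} - {r}" for k
      proof -
        obtain I where I: "I \<in># H" "I \<inter> V = {r, k}" using H k unfolding spanning_star_def by blast
        have "j \<notin> I" using I(2) k edge by auto
        then have "redirect i j I = I" by (simp add: redirect_def)
        then have "I \<in># ?H" using I(1) by (metis imageI set_image_mset)
        moreover have "I \<inter> (V - {j}) = {r, k}" using I(2) \<open>j \<notin> I\<close> by auto
        ultimately show ?thesis by blast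
      qed
      have contr: "magic_positive (card (V - {j})) (\<lambda>t. real (dilate_count (V - {j}) ?H t))"
      proof -
        consider "i = r" | "i \<noteq> r" "3 \<le> card (V - {j})" | "i \<noteq> r" "card V = 3"
          using less.prems(2) cardVj by linarith
        then show ?thesis
        proof cases
          case 1
          \<comment> \<open>Contraction towards the root turns the edge r j into the half-edge that
            a rooted star requires at r.\<close>
          obtain I where I: "I \<in># H" "I \<inter> V = {r, j}" using H edge unfolding spanning_star_def by blast
          have rI: "r \<in> redirect i j I" "redirect i j I \<inter> (V - {j}) \<subseteq> {r}"
            using I(2) 1 by (auto simp: redirect_def)
          have "rooted_star r (V - {j}) ?H"
            unfolding rooted_star_def
          proof (intro conjI ballI)
            fix k assume k: "k \<in> V - {j}"
            show "\<exists>I\<in>#?H. k \<in> I \<and> I \<inter> (V - {j}) \<subseteq> {r, k}"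
            proof (cases "k = r")
              case True
              then show ?thesis using rI I(1) by auto
            next
              case False
              then obtain I where "I \<in># ?H" "I \<inter> (V - {j}) = {r, k}" using wit k by blast
              then show ?thesis by (intro bexI[of _ I]) auto
            qed
          qed (use le2 in blast)
          then show ?thesis using V by (intro magic_positive_rooted_star) auto
        next
          case 2
          have "spanning_star r (V - {j}) ?H"
            unfolding spanning_star_def using r edge le2 wit by blast
          then show ?thesis using 2 V by (intro IH) auto
        next
          case 3
          have "card {r, i, j} = card V" using 3 edge by simp
          then have Vrij: "V = {r, i, j}" using V r edge by (intro card_subset_eq[symmetric]) auto
          then have Vj: "V - {j} = {r, i}" using edge by auto
          obtain I where I: "I \<in># H" "I \<inter> V = {r, i}" using H edge 3 unfolding spanning_star_def by blast
          obtain J where J: "J \<in># H" "J \<inter> V = {r, j}" using H edge unfolding spanning_star_def by blast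
          \<comment> \<open>After contraction the edges r i and r j are parallel, which is the
            doubled edge needed on two vertices.\<close>
          have "I \<noteq> J" using I J edge 3 by auto
          then obtain K where K: "H = add_mset I (add_mset J K)"
            using I(1) J(1) by (metis insert_DiffM insert_noteq_member)
          have "{r, i} \<subseteq> redirect i j I" "{r, i} \<subseteq> redirect i j J"
            using I(2) J(2) by (auto simp: redirect_def)
          then have "2 \<le> size {#I \<in># ?H. {r, i} \<subseteq> I#}" by (simp add: K)
          then have "magic_positive 2 (\<lambda>t. real (dilate_count {r, i} ?H t))"
            using 3 by (intro magic_positive_two_vertices) auto
          then show ?thesis using 3 cardVj by (simp add: Vj numeral_2_eq_2)
        qed
      qed
      show ?thesis unfolding G
        by (rule magic_positive_edge[OF V edge(1,2) magic_positive_add_times[OF V edge(5) mH contr] del])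
          (use edge in auto)
    qed
  next
    case False
    have crit: "\<exists>k\<in>V - {r}. I \<inter> V = {r, k} \<and> (\<forall>J\<in>#G - {#I#}. J \<inter> V \<noteq> {r, k})" if I: "I \<in># G" for I
    proof -
      have "\<forall>J\<in>#G - {#I#}. card (J \<inter> V) \<le> 2" using S by (auto simp: spanning_star_def dest: in_diffD)
      then obtain k where k: "k \<in> V - {r}" "\<not> (\<exists>J\<in>#G - {#I#}. J \<inter> V = {r, k})"
        using False I r unfolding spanning_star_def by blast
      obtain J where J: "J \<in># G" "J \<inter> V = {r, k}" using S k(1) unfolding spanning_star_def by blast
      have "J = I"
      proof (rule ccontr)
        assume "J \<noteq> I"
        then have "J \<in># G - {#I#}" using J(1) by (simp add: in_diff_count)
        then show False using k(2) J by blast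
      qed
      then show ?thesis using J k by blast
    qed
    \<comment> \<open>By minimality every summand is the only edge to its leaf, so no two summands
      share a leaf.\<close>
    have unique: "k \<notin> J" if u: "I \<in># G" "I \<inter> V = {r, k}" "J \<in># G - {#I#}" "k \<in> V" "k \<noteq> r" for I J k
    proof
      assume "k \<in> J"
      obtain l where l: "l \<in> V - {r}" "I \<inter> V = {r, l}" "\<forall>J\<in>#G - {#I#}. J \<inter> V \<noteq> {r, l}"
        using crit[OF u(1)] by blast
      have "l = k" using l(2) u(2,5) by (auto simp: doubleton_eq_iff)
      obtain m where m: "J \<inter> V = {r, m}" using crit[of J] u(3) by (meson in_diffD)
      then have "m = k" using \<open>k \<in> J\<close> u(4,5) by auto
      then show False using m l(3) u(3) \<open>l = k\<close> by blast
    qed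
    have "V \<noteq> {r}" using less.prems(2) by auto
    then obtain j where j: "j \<in> V" "j \<noteq> r" using r by blast
    then obtain e where e: "e \<in># G" "e \<inter> V = {r, j}" using S unfolding spanning_star_def by blast
    define H where "H = G - {#e#}"
    have G: "G = add_mset e H" using e by (simp add: H_def)
    have jH: "j \<notin> I" if "I \<in># H" for I
      using unique[OF e] that j by (simp add: H_def)
    have cardVj: "card V = Suc (card (V - {j}))" using V j by (metis card_Suc_Diff1)
    have H: "\<exists>I\<in>#H. I \<inter> V = {r, k}" if "k \<in> V - {j} - {r}" for k
    proof -
      obtain I where I: "I \<in># G" "I \<inter> V = {r, k}" using S \<open>k \<in> V - {j} - {r}\<close> unfolding spanning_star_def by blast
      have "I \<noteq> e" using I(2) e(2) that by (auto simp: doubleton_eq_iff)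
      then show ?thesis using I by (auto simp: G)
    qed
    have HVj: "I \<inter> (V - {j}) = I \<inter> V" if "I \<in># H" for I using jH[OF that] by auto
    have star: "spanning_star r (V - {j}) H"
      unfolding spanning_star_def
    proof (intro conjI ballI)
      show "r \<in> V - {j}" using r j by simp
      show "card (I \<inter> (V - {j})) \<le> 2" if "I \<in># H" for I
        using S that by (simp add: HVj spanning_star_def G)
      show "\<exists>I\<in>#H. I \<inter> (V - {j}) = {r, k}" if "k \<in> V - {j} - {r}" for k
        using H[OF that] HVj by auto
    qed
    have m': "magic_positive (card (V - {r, j})) (\<lambda>t. real (dilate_count (V - {r, j}) H t))"
      using V r j by (intro magic_positive_rooted_star[of _ r] rooted_star_of_spanning_star[OF _ star]) auto
    show ?thesis
    proof (cases "3 \<le> card (V - {j})")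
      case True
      then have "magic_positive (card (V - {j})) (\<lambda>t. real (dilate_count (V - {j}) H t))"
        using less.hyps[of H "V - {j}"] V star by (simp add: G)
      then show ?thesis unfolding G
        using j by (intro magic_positive_pendant[OF V e(2) _ jH] m') auto
    next
      case False
      \<comment> \<open>A lone edge on V - {j} is not magic positive in degree 2, so the pendant
        lemma does not apply. The term t (t+1)^2 / 2 of the full rule makes up for this, and the
        total is (1+t)^3.\<close>
      then have card2: "card (V - {j}) = 2" "card V = 3" using less.prems(2) cardVj by auto
      obtain k where k: "V - {j} = {r, k}" "k \<noteq> r"
      proof -
        obtain x y where "V - {j} = {x, y}" "x \<noteq> y" using card2(1) by (auto simp: card_2_iff)
        moreover have "r = x \<or> r = y" using calculation r j by auto
        ultimately show thesis using that[of x] that[of y] by (auto simp: insert_commute)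
      qed
      have kV: "k \<in> V" "k \<noteq> j" using k(1) by auto
      obtain f where f: "f \<in># H" "f \<inter> V = {r, k}" using H kV k by blast
      define K where "K = H - {#f#}"
      have HK: "H = add_mset f K" using f by (simp add: K_def)
      \<comment> \<open>Every summand is the edge to some leaf, and the leaves j and k are already
        taken by e and f.\<close>
      have K: "I \<inter> V = {}" if "I \<in># K" for I
      proof -
        have IH: "I \<in># H" using that by (simp add: HK)
        have jI: "j \<notin> I" using jH[OF IH] .
        have "I \<in># G - {#f#}" using that by (simp add: G HK)
        then have kI: "k \<notin> I" using unique[of f k I] f kV k(2) by (simp add: G)
        obtain l where "l \<in> V - {r}" "I \<inter> V = {r, l}" using crit[of I] IH by (auto simp: G)
        moreover have "V = {r, k, j}" using k(1) j by auto
        ultimately show ?thesis using jI kI by auto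
      qed
      have Vj2: "2 * dilate_count (V - {j}) H t = (t + 1) * (t + 2)" for t
        unfolding k(1) HK
      proof (rule dilate_count_single_edge)
        show "f \<inter> {r, k} = {r, k}" using f(2) by auto
        show "I \<inter> {r, k} = {}" if "I \<in># K" for I using K[OF that] r kV by auto
      qed (use k in simp)
      have Vk: "V - {r, j} = {k}" using k j by auto
      have del: "dilate_count (V - {r, j}) H t = 1 + t" for t
      proof -
        have "f \<inter> {k} = {k}" using f(2) by auto
        moreover have "dilate_count {k} K t = 1"
          by (rule dilate_count_no_edges) (use K kV in auto)
        ultimately show ?thesis
          using dilate_count_half_edge[of "{k}" f k K t] by (simp add: Vk HK dilate_count_empty)
      qed
      have "real (dilate_count V G t) = (1 + real t) * ((1 + real t) * ((1 + real t) * 1))" for t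
      proof -
        have "2 * dilate_count V G t = 2 * dilate_count V H t + 2 * t * dilate_count (V - {j}) H t + t * (t + 1) * (1 + t)"
          using dilate_count_edge[OF V e(2), of H t] j redirect_image_mset_absent[OF jH, of H r]
          by (simp add: G del)
        also have "dilate_count V H t = dilate_count (V - {j}) H t"
          by (rule dilate_count_isolated[OF V jH])
        also have "2 * dilate_count (V - {j}) H t + 2 * t * dilate_count (V - {j}) H t =
            (1 + t) * (2 * dilate_count (V - {j}) H t)" by (simp add: algebra_simps)
        also have "\<dots> + t * (t + 1) * (1 + t) = 2 * ((1 + t) * ((1 + t) * (1 + t)))"
          unfolding Vj2 by (simp add: algebra_simps)
        finally have "dilate_count V G t = (1 + t) * ((1 + t) * (1 + t))" by simp
        then show ?thesis by (simp add: algebra_simps)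
      qed
      moreover have "magic_positive (Suc (Suc (Suc 0))) (\<lambda>t. (1 + real t) * ((1 + real t) * ((1 + real t) * 1)))"
        by (intro magic_positive_times_Suc magic_positive_one)
      ultimately show ?thesis using card2 by (simp add: numeral_3_eq_3)
    qed
  qed
qed


subsection \<open>Parking function polytopes\<close>

definition parking_graph :: "nat \<Rightarrow> nat \<Rightarrow> 'n::finite set multiset" where
  "parking_graph a b = repeat_mset (a - 1) (mset_set {I. card I = 1}) + repeat_mset b (mset_set {I. card I = 2})"

lemma mem_parking_graph:
  "I \<in># parking_graph a b \<longleftrightarrow> (a > 1 \<and> card I = 1) \<or> (b > 0 \<and> card I = 2)"
  by (auto simp: parking_graph_def count_mset_set' simp flip: count_greater_zero_iff)

lemma size_filter_repeat_mset:
  "size (filter_mset P (repeat_mset k M)) = k * size (filter_mset P M)"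
  by (induction k) auto

lemma sum_lessThan_eq_choose: "(\<Sum>j<n. j) = n choose 2" for n :: nat
  by (induction n) (simp_all add: numeral_2_eq_2)

text \<open>These are all pairs except those inside the complement of S. The difference of the two
  binomials is written as the sum of the \<open>card S\<close> largest indices, to match the bounds
  a + b * j on the sorted entries of a parking function.\<close>

lemma card_pairs_meeting:
  fixes S :: "'n::finite set"
  shows "card {I. card I = 2 \<and> I \<inter> S \<noteq> {}} = (\<Sum>j=CARD('n) - card S..<CARD('n). j)"
proof -
  let ?n = "CARD('n)"
  have "{I::'n set. card I = 2} = {I. card I = 2 \<and> I \<inter> S \<noteq> {}} \<union> {I. I \<subseteq> - S \<and> card I = 2}" by auto
  then have "card {I::'n set. card I = 2} =
      card ({I. card I = 2 \<and> I \<inter> S \<noteq> {}} \<union> {I. I \<subseteq> - S \<and> card I = 2})" by simp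
  also have "\<dots> = card {I. card I = 2 \<and> I \<inter> S \<noteq> {}} + card {I. I \<subseteq> - S \<and> card I = 2}"
    by (rule card_Un_disjoint) auto
  also have "card {I. I \<subseteq> - S \<and> card I = 2} = (?n - card S) choose 2"
    by (simp add: n_subsets Compl_eq_Diff_UNIV card_Diff_subset)
  also have "card {I::'n set. card I = 2} = ?n choose 2"
    using n_subsets[of "UNIV :: 'n set" 2] by simp
  finally have "(\<Sum>j<?n. j) = card {I. card I = 2 \<and> I \<inter> S \<noteq> {}} + (\<Sum>j<?n - card S. j)"
    by (simp only: sum_lessThan_eq_choose)
  moreover have "(\<Sum>j<?n. j) = (\<Sum>j<?n - card S. j) + (\<Sum>j=?n - card S..<?n. j)"
    using sum.atLeastLessThan_concat[of 0 "?n - card S" ?n "\<lambda>j. j"] by (simp add: atLeast0LessThan)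
  ultimately show ?thesis by simp
qed

text \<open>The value is the largest total that \<open>card S\<close> entries of a parking function
  can reach after 1 is subtracted from each.\<close>

lemma incidence_parking_graph:
  fixes S :: "'n::finite set"
  shows "incidence (parking_graph a b) S = (\<Sum>j=CARD('n) - card S..<CARD('n). (a - 1) + b * j)"
proof -
  have "card {I. card I = 1 \<and> I \<inter> S \<noteq> {}} = card S"
  proof -
    have "{I. card I = 1 \<and> I \<inter> S \<noteq> {}} = (\<lambda>i. {i}) ` S" by (auto simp: card_1_singleton_iff)
    then show ?thesis by (simp add: card_image)
  qed
  moreover have "size {#I \<in># mset_set {I. card I = k}. I \<inter> S \<noteq> {}#} = card {I. card I = k \<and> I \<inter> S \<noteq> {}}" for k
    by (simp add: filter_mset_mset_set)
  moreover have "card S \<le> CARD('n)" by (simp add: card_mono)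
  ultimately show ?thesis
    by (simp add: incidence_def parking_graph_def size_filter_repeat_mset card_pairs_meeting
        sum.distrib sum_distrib_left)
qed

section \<open>The parking polytope as a shifted polymatroid\<close>

lemma sum_lessThan_card_le: "finite A \<Longrightarrow> (\<Sum>j<card A. j) \<le> \<Sum>A" for A :: "nat set"
proof (induction A rule: finite_linorder_max_induct)
  case (insert b A)
  then have "A \<subseteq> {..<b}" by auto
  then have "card A \<le> b" using card_mono[of "{..<b}" A] by simp
  moreover have "b \<notin> A" using insert by auto
  ultimately show ?case using insert by simp
qed simp

lemma sum_le_top_sum:
  fixes J :: "nat set"
  assumes "J \<subseteq> {..<n}"
  shows "(\<Sum>j\<in>J. c + b * j) \<le> (\<Sum>j=n - card J..<n. c + b * j)"
proof -
  have fin: "finite J" using assms by (rule finite_subset) simp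
  have le: "card J \<le> n" using card_mono[OF _ assms] by simp
  have "(\<Sum>j<n. j) = \<Sum>J + \<Sum>({..<n} - J)"
    using sum.subset_diff[OF assms, of "\<lambda>j. j"] by (simp add: add.commute)
  moreover have "(\<Sum>j<n. j) = (\<Sum>j<n - card J. j) + (\<Sum>j=n - card J..<n. j)"
    using sum.atLeastLessThan_concat[of 0 "n - card J" n "\<lambda>j. j"] by (simp add: atLeast0LessThan)
  moreover have "(\<Sum>j<n - card J. j) \<le> \<Sum>({..<n} - J)"
    using sum_lessThan_card_le[of "{..<n} - J"] card_Diff_subset[OF fin assms] by simp
  ultimately have "\<Sum>J \<le> (\<Sum>j=n - card J..<n. j)" by simp
  then have "b * \<Sum>J \<le> b * (\<Sum>j=n - card J..<n. j)" by simp
  then show ?thesis using le by (simp add: sum.distrib sum_distrib_left)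
qed

text \<open>Serves twice: to sort the values of a parking function and to sort the coefficients of a
  linear form.\<close>

lemma sorted_enumeration:
  fixes c :: "'n::finite \<Rightarrow> 'b::linorder"
  obtains e where "bij_betw e {..<CARD('n)} UNIV" "\<And>i j. i \<le> j \<Longrightarrow> j < CARD('n) \<Longrightarrow> c (e i) \<le> c (e j)"
proof -
  obtain xs where xs: "set xs = (UNIV :: 'n set)" "distinct xs"
    using finite_distinct_list[of "UNIV :: 'n set"] by auto
  define ys where "ys = sort_key c xs"
  have ys: "set ys = UNIV" "distinct ys" "sorted (map c ys)" using xs by (simp_all add: ys_def)
  have len: "length ys = CARD('n)" using distinct_card[OF ys(2)] ys(1) by simp
  have "bij_betw ((!) ys) {..<CARD('n)} UNIV"
    by (rule bij_betw_nth) (use ys len in simp_all)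
  moreover have "c (ys ! i) \<le> c (ys ! j)" if "i \<le> j" "j < CARD('n)" for i j
    using sorted_nth_mono[OF ys(3), of i j] that len by simp
  ultimately show thesis by (rule that)
qed

lemma nondec_rearrangement_eq:
  fixes \<beta> :: "'n::finite \<Rightarrow> nat"
  assumes e: "bij_betw e {..<CARD('n)} UNIV" and mono: "\<And>i j. i \<le> j \<Longrightarrow> j < CARD('n) \<Longrightarrow> \<beta> (e i) \<le> \<beta> (e j)"
  shows "nondec_rearrangement \<beta> = map (\<lambda>j. \<beta> (e j)) [0..<CARD('n)]"
proof -
  have "distinct (map e [0..<CARD('n)])" "set (map e [0..<CARD('n)]) = UNIV"
    using e by (auto simp: distinct_map bij_betw_def atLeast0LessThan)
  then have "mset_set (UNIV :: 'n set) = mset (map e [0..<CARD('n)])"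
    by (metis mset_set_set)
  then have "image_mset \<beta> (mset_set UNIV) = mset (map (\<lambda>j. \<beta> (e j)) [0..<CARD('n)])"
    by (simp add: multiset.map_comp comp_def)
  moreover have "sorted (map (\<lambda>j. \<beta> (e j)) [0..<CARD('n)])"
    using mono by (auto simp: sorted_iff_nth_mono)
  ultimately show ?thesis
    unfolding nondec_rearrangement_def by (simp only: sorted_list_of_multiset_mset sorted_sort_id)
qed

lemma parking_function_iff:
  fixes \<beta> :: "'n::finite \<Rightarrow> nat"
  assumes e: "bij_betw e {..<CARD('n)} UNIV" and mono: "\<And>i j. i \<le> j \<Longrightarrow> j < CARD('n) \<Longrightarrow> \<beta> (e i) \<le> \<beta> (e j)"
  shows "parking_function (a # replicate (CARD('n) - 1) b) \<beta> \<longleftrightarrow>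
    (\<forall>i. \<beta> i > 0) \<and> (\<forall>k<CARD('n). \<beta> (e k) \<le> a + b * k)"
proof -
  have "sum_list (take (Suc k) (a # replicate (CARD('n) - 1) b)) = a + b * k" if "k < CARD('n)" for k
    using that by (simp add: sum_list_replicate min_def)
  moreover have "nondec_rearrangement \<beta> = map (\<lambda>j. \<beta> (e j)) [0..<CARD('n)]"
    by (rule nondec_rearrangement_eq[OF e]) (rule mono)
  ultimately show ?thesis unfolding parking_function_def by auto
qed

text \<open>Written through the increments of w, the difference of the two sides is a nonnegative
  combination of tail differences. The induction runs down from n and keeps w k as a common lower
  bound for the remaining weights.\<close>

lemma abel_summation_le:
  fixes w Y U :: "nat \<Rightarrow> real"
  assumes mono: "\<And>i j. i \<le> j \<Longrightarrow> j < n \<Longrightarrow> w i \<le> w j" and nonneg: "\<And>i. i < n \<Longrightarrow> w i \<ge> 0"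
    and tails: "\<And>k. k \<le> n \<Longrightarrow> (\<Sum>j=k..<n. Y j) \<le> (\<Sum>j=k..<n. U j)"
  shows "(\<Sum>j<n. w j * Y j) \<le> (\<Sum>j<n. w j * U j)"
proof -
  define D where "D j = U j - Y j" for j
  have D: "(\<Sum>j=k..<n. D j) \<ge> 0" if "k \<le> n" for k
    using tails[OF that] by (simp add: D_def sum_subtractf)
  \<comment> \<open>At k = n the tail is empty and nothing is known about w n, hence the case
    distinction.\<close>
  have "(\<Sum>j=k..<n. w j * D j) \<ge> (if k < n then w k * (\<Sum>j=k..<n. D j) else 0)" if "k \<le> n" for k
    using that
  proof (induction k rule: inc_induct)
    case (step k)
    have split: "sum f {k..<n} = f k + sum f {Suc k..<n}" for f :: "nat \<Rightarrow> real"
      using step.hyps by (simp add: sum.atLeast_Suc_lessThan)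
    have "w k * (\<Sum>j=Suc k..<n. D j) \<le> (\<Sum>j=Suc k..<n. w j * D j)"
    proof (cases "Suc k < n")
      case True
      have "w k * (\<Sum>j=Suc k..<n. D j) \<le> w (Suc k) * (\<Sum>j=Suc k..<n. D j)"
        using D[of "Suc k"] mono[of k "Suc k"] True by (intro mult_right_mono) auto
      then show ?thesis using step.IH True by simp
    next
      case False
      then show ?thesis using step.hyps by simp
    qed
    then show ?case using step.hyps by (simp add: split distrib_left)
  qed simp
  from this[of 0] have "(\<Sum>j=0..<n. w j * D j) \<ge> 0"
    using D[of 0] nonneg[of 0] by (cases "n = 0") (auto intro: order_trans[OF mult_nonneg_nonneg])
  then show ?thesis by (simp add: D_def right_diff_distrib sum_subtractf atLeast0LessThan)
qed

definition parking_inequalities :: "nat \<Rightarrow> nat \<Rightarrow> (real ^ 'n::finite) set" where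
  "parking_inequalities a b =
     {x. (\<forall>i. 1 \<le> x $ i) \<and> (\<forall>S. (\<Sum>i\<in>S. x $ i - 1) \<le> real (incidence (parking_graph a b) S))}"

lemma convex_parking_inequalities: "convex (parking_inequalities a b :: (real ^ 'n::finite) set)"
proof (rule convexI)
  fix x y :: "real ^ 'n" and u v :: real
  assume xy: "x \<in> parking_inequalities a b" "y \<in> parking_inequalities a b" and uv: "0 \<le> u" "0 \<le> v" "u + v = 1"
  have eq: "(u *\<^sub>R x + v *\<^sub>R y) $ i - 1 = u * (x $ i - 1) + v * (y $ i - 1)" for i
    using uv(3) by (simp add: algebra_simps)
  have "1 \<le> (u *\<^sub>R x + v *\<^sub>R y) $ i" for i
  proof -
    have "0 \<le> u * (x $ i - 1) + v * (y $ i - 1)" using xy uv by (simp add: parking_inequalities_def)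
    then show ?thesis using eq[of i] by linarith
  qed
  moreover have "(\<Sum>i\<in>S. (u *\<^sub>R x + v *\<^sub>R y) $ i - 1) \<le> real (incidence (parking_graph a b) S)" for S
  proof -
    have "(\<Sum>i\<in>S. (u *\<^sub>R x + v *\<^sub>R y) $ i - 1) = u * (\<Sum>i\<in>S. x $ i - 1) + v * (\<Sum>i\<in>S. y $ i - 1)"
      unfolding eq by (simp add: sum.distrib sum_distrib_left)
    also have "\<dots> \<le> real (incidence (parking_graph a b) S)"
      using xy uv by (intro convex_bound_le) (auto simp: parking_inequalities_def)
    finally show ?thesis .
  qed
  ultimately show "u *\<^sub>R x + v *\<^sub>R y \<in> parking_inequalities a b" by (simp add: parking_inequalities_def)
qed

lemma parking_function_satisfies_inequalities:
  fixes \<beta> :: "'n::finite \<Rightarrow> nat"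
  assumes a: "a > 0" and \<beta>: "parking_function (a # replicate (CARD('n) - 1) b) \<beta>"
  shows "(\<chi> i. real (\<beta> i)) \<in> parking_inequalities a b"
proof -
  obtain e where e: "bij_betw e {..<CARD('n)} UNIV" "\<And>i j. i \<le> j \<Longrightarrow> j < CARD('n) \<Longrightarrow> \<beta> (e i) \<le> \<beta> (e j)"
    by (rule sorted_enumeration[of \<beta>]) (rule that)
  have pos: "\<beta> i > 0" for i using \<beta> parking_function_iff[of e \<beta>, OF e] by simp
  have le: "\<beta> (e k) \<le> a + b * k" if "k < CARD('n)" for k using \<beta> parking_function_iff[of e \<beta>, OF e] that by simp
  have "(\<Sum>i\<in>S. real (\<beta> i) - 1) \<le> real (incidence (parking_graph a b) S)" for S
  proof -
    define J where "J = {j. j < CARD('n) \<and> e j \<in> S}"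
    have J: "J \<subseteq> {..<CARD('n)}" by (auto simp: J_def)
    have inj: "inj_on e J" using e(1) J by (meson bij_betw_def inj_on_subset)
    have "S = e ` J" using e(1) by (auto simp: J_def bij_betw_def image_iff)
    then have card: "card S = card J" using inj by (simp add: card_image)
    have "(\<Sum>i\<in>S. real (\<beta> i) - 1) = (\<Sum>j\<in>J. real (\<beta> (e j)) - 1)"
      unfolding \<open>S = e ` J\<close> by (simp add: sum.reindex[OF inj])
    \<comment> \<open>The entry of sorted rank j is at most (a - 1) + b * j after the shift. The set
      J of ranks that S occupies is arbitrary, so it is compared with the top \<open>card J\<close>
      ranks afterwards.\<close>
    also have "\<dots> \<le> (\<Sum>j\<in>J. real ((a - 1) + b * j))"
    proof (rule sum_mono)
      fix j assume "j \<in> J"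
      then have "\<beta> (e j) \<le> (a - 1) + b * j + 1" using le[of j] a by (simp add: J_def)
      then have "real (\<beta> (e j)) \<le> real ((a - 1) + b * j + 1)" by (simp only: of_nat_le_iff)
      then show "real (\<beta> (e j)) - 1 \<le> real ((a - 1) + b * j)" by simp
    qed
    also have "\<dots> \<le> real (incidence (parking_graph a b) S)"
      unfolding incidence_parking_graph card of_nat_sum[symmetric] of_nat_le_iff by (rule sum_le_top_sum[OF J])
    finally show ?thesis .
  qed
  then show ?thesis using pos by (simp add: parking_inequalities_def Suc_le_eq)
qed

lemma finite_parking_functions:
  "finite {\<beta> :: 'n::finite \<Rightarrow> nat. parking_function (a # replicate (CARD('n) - 1) b) \<beta>}"
proof (rule finite_subset)
  show "{\<beta> :: 'n \<Rightarrow> nat. parking_function (a # replicate (CARD('n) - 1) b) \<beta>} \<subseteq> PiE UNIV (\<lambda>_. {..a + b * CARD('n)})"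
  proof
    fix \<beta> :: "'n \<Rightarrow> nat" assume "\<beta> \<in> {\<beta>. parking_function (a # replicate (CARD('n) - 1) b) \<beta>}"
    then have \<beta>: "parking_function (a # replicate (CARD('n) - 1) b) \<beta>" by simp
    obtain e where e: "bij_betw e {..<CARD('n)} UNIV" "\<And>i j. i \<le> j \<Longrightarrow> j < CARD('n) \<Longrightarrow> \<beta> (e i) \<le> \<beta> (e j)"
      by (rule sorted_enumeration[of \<beta>]) (rule that)
    have "\<beta> i \<le> a + b * CARD('n)" for i
    proof -
      have "i \<in> e ` {..<CARD('n)}" using e(1) by (simp add: bij_betw_def)
      then obtain k where k: "k < CARD('n)" "i = e k" by auto
      then have "\<beta> i \<le> a + b * k" using \<beta> parking_function_iff[of e \<beta>, OF e] by simp
      also have "\<dots> \<le> a + b * CARD('n)" using k by simp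
      finally show ?thesis .
    qed
    then show "\<beta> \<in> PiE UNIV (\<lambda>_. {..a + b * CARD('n)})" by (simp add: PiE_def)
  qed
  show "finite (PiE (UNIV :: 'n set) (\<lambda>_. {..a + b * CARD('n)}))" by (intro finite_PiE) auto
qed

lemma exists_maximizing_parking_function:
  fixes c z :: "real ^ 'n::finite"
  assumes a: "a > 0" and z: "z \<in> parking_inequalities a b"
  obtains \<beta> where "parking_function (a # replicate (CARD('n) - 1) b) \<beta>" "c \<bullet> z \<le> c \<bullet> (\<chi> i. real (\<beta> i))"
proof -
  let ?n = "CARD('n)"
  obtain e where e: "bij_betw e {..<?n} UNIV" "\<And>i j. i \<le> j \<Longrightarrow> j < ?n \<Longrightarrow> c $ e i \<le> c $ e j"
    by (rule sorted_enumeration[of "\<lambda>i. c $ i"]) (rule that)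
  define pos where "pos = inv_into {..<?n} e"
  \<comment> \<open>The greedy vertex: coordinates with positive coefficient get the largest value
    allowed at their rank, all others the least value 1. Positive coefficients occupy the last
    ranks, so \<beta> is nondecreasing along e.\<close>
  define \<beta> where "\<beta> i = (if c $ i > 0 then a + b * pos i else 1)" for i
  have pos: "pos (e j) = j" if "j < ?n" for j
    using e(1) that by (simp add: pos_def bij_betw_def)
  have \<beta>e: "\<beta> (e j) = (if c $ e j > 0 then a + b * j else 1)" if "j < ?n" for j
    using that by (simp add: \<beta>_def pos)
  have mono: "\<beta> (e i) \<le> \<beta> (e j)" if "i \<le> j" "j < ?n" for i j
    using e(2)[OF that] that a by (auto simp: \<beta>e intro!: trans_le_add1)
  have park: "parking_function (a # replicate (?n - 1) b) \<beta>"
  proof -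
    have "parking_function (a # replicate (?n - 1) b) \<beta> \<longleftrightarrow>
        (\<forall>i. \<beta> i > 0) \<and> (\<forall>k<?n. \<beta> (e k) \<le> a + b * k)"
      by (rule parking_function_iff[OF e(1)]) (rule mono)
    moreover have "\<beta> i > 0" for i using a by (simp add: \<beta>_def)
    ultimately show ?thesis using a by (simp add: \<beta>e)
  qed
  \<comment> \<open>Replacing negative coefficients by 0 can only enlarge the form at z, since
    \<open>z $ i - 1\<close> is nonnegative. It changes nothing at the greedy vertex, whose shifted
    coordinates vanish there.\<close>
  define w where "w j = max 0 (c $ e j)" for j
  define Y where "Y j = z $ e j - 1" for j
  define U where "U j = real ((a - 1) + b * j)" for j
  have reindex: "(\<Sum>i\<in>UNIV. f i) = (\<Sum>j<?n. f (e j))" for f :: "'n \<Rightarrow> real"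
    using sum.reindex_bij_betw[OF e(1), of f] by simp
  have "(\<Sum>i\<in>UNIV. c $ i * (z $ i - 1)) \<le> (\<Sum>j<?n. w j * Y j)"
    unfolding reindex
  proof (rule sum_mono)
    fix j
    have "Y j \<ge> 0" using z by (simp add: Y_def parking_inequalities_def)
    then show "c $ e j * (z $ e j - 1) \<le> w j * Y j"
      unfolding Y_def w_def by (intro mult_right_mono) auto
  qed
  also have "\<dots> \<le> (\<Sum>j<?n. w j * U j)"
  proof (rule abel_summation_le)
    show "w i \<le> w j" if "i \<le> j" "j < ?n" for i j using e(2)[OF that] by (auto simp: w_def)
    \<comment> \<open>The inequality of the polymatroid for the last ranks is attained by the greedy
      values.\<close>
    show "(\<Sum>j=k..<?n. Y j) \<le> (\<Sum>j=k..<?n. U j)" if "k \<le> ?n" for k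
    proof -
      have inj: "inj_on e {k..<?n}" using e(1) by (auto simp: bij_betw_def intro: inj_on_subset)
      have "(\<Sum>j=k..<?n. Y j) = (\<Sum>i\<in>e ` {k..<?n}. z $ i - 1)"
        by (simp add: sum.reindex[OF inj] Y_def)
      also have "\<dots> \<le> real (incidence (parking_graph a b) (e ` {k..<?n}))"
        using z unfolding parking_inequalities_def by blast
      also have "\<dots> = (\<Sum>j=k..<?n. U j)"
        using that by (simp add: incidence_parking_graph card_image[OF inj] U_def)
      finally show ?thesis .
    qed
  qed (simp add: w_def)
  also have "\<dots> = (\<Sum>j<?n. c $ e j * (real (\<beta> (e j)) - 1))"
    by (rule sum.cong) (use a in \<open>auto simp: w_def U_def \<beta>e of_nat_diff max_def\<close>)
  also have "\<dots> = (\<Sum>i\<in>UNIV. c $ i * (real (\<beta> i) - 1))" unfolding reindex ..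
  finally have "c \<bullet> z \<le> c \<bullet> (\<chi> i. real (\<beta> i))"
    by (simp add: inner_vec_def right_diff_distrib sum_subtractf)
  with park show thesis by (rule that)
qed

theorem parking_polytope_eq_inequalities:
  assumes a: "a > 0"
  shows "(parking_polytope_ab a b :: (real ^ 'n::finite) set) = parking_inequalities a b"
proof
  let ?P = "{(\<chi> i. real (\<beta> i)) | \<beta>. parking_function (a # replicate (CARD('n) - 1) b) \<beta>} :: (real ^ 'n) set"
  show "(parking_polytope_ab a b :: (real ^ 'n) set) \<subseteq> parking_inequalities a b"
    unfolding parking_polytope_ab_def parking_polytope_def
    by (rule hull_minimal)
      (use parking_function_satisfies_inequalities[OF a] convex_parking_inequalities in blast)+
  have "finite ?P" using finite_parking_functions[of a b, where 'n = 'n] by (simp add: setcompr_eq_image)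
  then have closed: "closed (convex hull ?P)"
    by (intro compact_imp_closed compact_convex_hull finite_imp_compact)
  show "parking_inequalities a b \<subseteq> (parking_polytope_ab a b :: (real ^ 'n) set)"
    unfolding parking_polytope_ab_def parking_polytope_def
  proof
    fix z :: "real ^ 'n" assume z: "z \<in> parking_inequalities a b"
    show "z \<in> convex hull ?P"
    proof (rule ccontr)
      assume "z \<notin> convex hull ?P"
      then obtain c d where c: "c \<bullet> z < d" "\<forall>x\<in>convex hull ?P. c \<bullet> x > d"
        using separating_hyperplane_closed_point[OF convex_convex_hull closed] by blast
      \<comment> \<open>The hyperplane has z on its lower side, so the maximising parking function
        is taken for - c.\<close>
      obtain \<beta> where \<beta>: "parking_function (a # replicate (CARD('n) - 1) b) \<beta>"
          "- c \<bullet> z \<le> - c \<bullet> (\<chi> i. real (\<beta> i))"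
        by (rule exists_maximizing_parking_function[OF a z])
      have "(\<chi> i. real (\<beta> i)) \<in> convex hull ?P" using \<beta>(1) by (intro hull_inc) blast
      then show False using c \<beta>(2) by fastforce
    qed
  qed
qed

section \<open>Lattice points and dimension of the parking polytope\<close>

lemma card_lattice_points_parking_polytope:
  assumes a: "a > 0" and t: "t > 0"
  shows "card (lattice_points ((\<lambda>x. real t *\<^sub>R x) ` (parking_polytope_ab a b :: (real ^ 'n::finite) set))) =
    dilate_count UNIV (parking_graph a b :: 'n set multiset) t"
proof -
  let ?f = "\<lambda>S :: 'n set. t * incidence (parking_graph a b) S"
  \<comment> \<open>The dilate of the all-ones vector is the constant vector t, so the shift is by
    t.\<close>
  let ?\<phi> = "\<lambda>y. (\<chi> i. real (y i + t)) :: real ^ 'n"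
  have "lattice_points ((\<lambda>x. real t *\<^sub>R x) ` parking_inequalities a b) = ?\<phi> ` polymatroid_points UNIV ?f"
  proof (intro equalityI subsetI)
    fix x :: "real ^ 'n" assume "x \<in> lattice_points ((\<lambda>x. real t *\<^sub>R x) ` parking_inequalities a b)"
    then obtain v where v: "x = real t *\<^sub>R v" "v \<in> parking_inequalities a b" and int: "\<And>i. x $ i \<in> \<int>"
      unfolding lattice_points_def by blast
    have "\<exists>m::nat. x $ i = real (m + t)" for i
    proof -
      have "1 \<le> v $ i" using v(2) by (simp add: parking_inequalities_def)
      then have "x $ i \<ge> real t" using t by (simp add: v(1))
      moreover obtain k where k: "x $ i = of_int k" using int[of i] by (auto elim: Ints_cases)
      ultimately have "k \<ge> int t" by linarith
      then have "x $ i = real (nat (k - int t) + t)" using k by simp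
      then show ?thesis by blast
    qed
    then obtain y where y: "\<And>i. x $ i = real (y i + t)" by metis
    have "sum y S \<le> ?f S" for S
    proof -
      have "real (sum y S) = real t * (\<Sum>i\<in>S. v $ i - 1)"
      proof -
        have "real (y i) = real t * (v $ i - 1)" for i
          using y[of i] by (simp add: v(1) algebra_simps)
        then show ?thesis by (simp add: sum_distrib_left)
      qed
      also have "\<dots> \<le> real t * real (incidence (parking_graph a b) S)"
        using v(2) by (intro mult_left_mono) (auto simp: parking_inequalities_def)
      finally show ?thesis by (simp only: of_nat_mult[symmetric] of_nat_le_iff)
    qed
    then have "y \<in> polymatroid_points UNIV ?f" by (simp add: polymatroid_points_def)
    moreover have "x = ?\<phi> y" using y by (simp add: vec_eq_iff)
    ultimately show "x \<in> ?\<phi> ` polymatroid_points UNIV ?f" by blast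
  next
    fix x assume "x \<in> ?\<phi> ` polymatroid_points UNIV ?f"
    then obtain y where y: "x = ?\<phi> y" "y \<in> polymatroid_points UNIV ?f" by blast
    define v where "v = (1 / real t) *\<^sub>R x"
    have vi: "v $ i - 1 = real (y i) / real t" for i
      using t by (simp add: v_def y(1) field_simps)
    have "v \<in> parking_inequalities a b"
      unfolding parking_inequalities_def
    proof (intro CollectI conjI allI)
      show "1 \<le> v $ i" for i using vi[of i] t by (smt (verit) divide_nonneg_nonneg of_nat_0_le_iff)
      show "(\<Sum>i\<in>S. v $ i - 1) \<le> real (incidence (parking_graph a b) S)" for S
      proof -
        have "sum y S \<le> ?f S" using y(2) by (simp add: polymatroid_points_def)
        then have "real (sum y S) \<le> real t * real (incidence (parking_graph a b) S)"
          by (simp only: of_nat_mult[symmetric] of_nat_le_iff)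
        then show ?thesis unfolding vi using t by (simp add: sum_divide_distrib[symmetric] field_simps)
      qed
    qed
    moreover have "x = real t *\<^sub>R v" using t by (simp add: v_def)
    moreover have "x $ i \<in> \<int>" for i by (simp add: y(1))
    ultimately show "x \<in> lattice_points ((\<lambda>x. real t *\<^sub>R x) ` parking_inequalities a b)"
      by (auto simp: lattice_points_def)
  qed
  moreover have "inj ?\<phi>" by (auto simp: inj_def vec_eq_iff)
  ultimately show ?thesis
    unfolding parking_polytope_eq_inequalities[OF a] dilate_count_def
    by (simp add: card_image inj_on_subset)
qed

text \<open>The all-ones point and its translates by unit vectors belong to the polytope, because
  every nonempty S has incidence at least 1. The condition on a and n excludes the case of a single
  point.\<close>

lemma aff_dim_parking_polytope:
  assumes a: "a > 0" "b > 0" and nd: "a > 1 \<or> CARD('n) > 1"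
  shows "aff_dim (parking_polytope_ab a b :: (real ^ 'n::finite) set) = int (CARD('n))"
proof -
  let ?X = "parking_polytope_ab a b :: (real ^ 'n) set"
  let ?one = "(\<chi> i. 1) :: real ^ 'n"
  have inc: "1 \<le> incidence (parking_graph a b) S" if "S \<noteq> {}" for S :: "'n set"
  proof -
    have "card S > 0" using that by (simp add: card_gt_0_iff)
    \<comment> \<open>The largest index occurs in the incidence sum of every nonempty S, and its
      term alone is at least 1.\<close>
    then have "CARD('n) - 1 \<in> {CARD('n) - card S..<CARD('n)}" by auto
    then have "(a - 1) + b * (CARD('n) - 1) \<le> incidence (parking_graph a b) S"
      unfolding incidence_parking_graph by (intro member_le_sum) auto
    moreover have "1 \<le> (a - 1) + b * (CARD('n) - 1)" using a nd by (cases "a > 1") auto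
    ultimately show ?thesis by linarith
  qed
  have one: "?one \<in> ?X"
    unfolding parking_polytope_eq_inequalities[OF a(1)] by (simp add: parking_inequalities_def)
  have axis: "?one + axis i 1 \<in> ?X" for i
  proof -
    have "(\<Sum>k\<in>S. (?one + axis i 1) $ k - 1) \<le> real (incidence (parking_graph a b) S)" for S
    proof (cases "S = {}")
      case False
      have "(\<Sum>k\<in>S. (?one + axis i 1) $ k - 1) = (\<Sum>k\<in>S. if k = i then 1 else 0)"
        by (intro sum.cong refl) (simp add: axis_def)
      also have "\<dots> \<le> 1" by simp
      also have "1 \<le> real (incidence (parking_graph a b) S)" using inc[OF False] by simp
      finally show ?thesis .
    qed simp
    then show ?thesis
      unfolding parking_polytope_eq_inequalities[OF a(1)]
      by (simp add: parking_inequalities_def axis_def)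
  qed
  define Y where "Y = (\<lambda>x. - ?one + x) ` ?X"
  have "0 \<in> Y" using one unfolding Y_def by (intro image_eqI[of _ _ ?one]) auto
  then have "aff_dim Y = int (dim Y)" by (intro aff_dim_zero hull_inc)
  moreover have "Basis \<subseteq> Y"
  proof
    fix u :: "real ^ 'n" assume "u \<in> Basis"
    then obtain i where "u = axis i 1" by (auto simp: Basis_vec_def)
    then show "u \<in> Y" using axis[of i] unfolding Y_def by (intro image_eqI[of _ _ "?one + u"]) auto
  qed
  then have "span Y = UNIV" by (metis span_Basis span_mono top.extremum_uniqueI)
  then have "dim Y = DIM(real ^ 'n)" using dim_eq_full[of Y] by blast
  moreover have "aff_dim Y = aff_dim ?X" unfolding Y_def by (rule aff_dim_translation_eq)
  ultimately show ?thesis by simp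
qed

section \<open>From magic positivity to real roots, and the ranges of the parameters\<close>

lemma real_rooted_h_star_poly_if_magic_positive:
  assumes d: "d = nat (aff_dim P)" and F: "magic_positive d F" "F 0 > 0"
    and card: "\<And>t. t > 0 \<Longrightarrow> F t = real (card (lattice_points ((\<lambda>x. real t *\<^sub>R x) ` P)))"
  shows "real_rooted (h_star_poly P)"
proof -
  obtain c where c: "\<forall>i. c i \<ge> 0" "\<And>t. F t = (\<Sum>i\<le>d. c i * (real t ^ i * (1 + real t) ^ (d - i)))"
    using F(1) unfolding magic_positive_def by auto
  let ?h = "\<Sum>i\<le>d. smult (c i) (refined_eulerian d i)"
  have "h_star_poly P = ?h"
  proof (rule h_star_poly_eqI[OF d])
    show "degree ?h \<le> d"
      by (intro degree_sum_le) (auto intro: order_trans[OF degree_smult_le] degree_refined_eulerian)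
    fix t :: nat assume t: "t > 0"
    have "binomial_expansion d ?h (real t) = F t"
      unfolding c(2) binomial_expansion_sum binomial_expansion_smult
      by (intro sum.cong refl) (simp add: binomial_expansion_refined_eulerian)
    then show "binomial_expansion d ?h (real t) = real (card (lattice_points ((\<lambda>x. real t *\<^sub>R x) ` P)))"
      by (simp add: card[OF t])
  qed
  \<comment> \<open>At t = 0 only the term i = 0 survives, so c 0 = F 0. This is the strictly
    positive coefficient that the cone lemma asks for.\<close>
  moreover have "F 0 = (\<Sum>i\<in>{0}. c i * (real 0 ^ i * (1 + real 0) ^ (d - i)))"
    unfolding c(2) by (rule sum.mono_neutral_right) auto
  then have "c 0 > 0" using F(2) by simp
  ultimately show ?thesis
    using real_rooted_refined_eulerian_combination[of d c 0] c(1) by simp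
qed

lemma dilate_count_zero: "finite V \<Longrightarrow> dilate_count V G 0 = 1"
  using dilate_count_no_edges[of V "{#}" 0] by (simp add: dilate_count_def)

lemma UNIV_two:
  assumes "CARD('n::finite) = 2"
  obtains r s :: "'n::finite" where "r \<noteq> s" "UNIV = {r, s}"
  using assms by (auto simp: card_2_iff)

text \<open>For a > 1 every vertex has a half-edge. Otherwise the complete graph on at least three
  vertices contains a spanning star, or two vertices are joined by b \<ge> 2 parallel edges.\<close>

lemma magic_positive_parking_graph:
  assumes "a > 0" "b > 0"
    and ex: "a > 1 \<or> CARD('n::finite) > 2 \<or> (CARD('n::finite) = 2 \<and> b > 1)"
  shows "magic_positive CARD('n::finite) (\<lambda>t. real (dilate_count UNIV (parking_graph a b :: 'n::finite set multiset) t))"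
proof -
  let ?G = "parking_graph a b :: 'n set multiset"
  have le2: "\<forall>I\<in>#?G. card (I \<inter> UNIV) \<le> 2" by (auto simp: mem_parking_graph)
  consider "a > 1" | "CARD('n) > 2" | "a = 1" "CARD('n) = 2" "b > 1" using ex assms by linarith
  then show ?thesis
  proof cases
    case 1
    have "rooted_star r UNIV ?G" for r
      unfolding rooted_star_def
    proof (intro conjI ballI)
      show "\<exists>I\<in>#?G. j \<in> I \<and> I \<inter> UNIV \<subseteq> {r, j}" for j
        using 1 by (intro bexI[of _ "{j}"]) (auto simp: mem_parking_graph)
    qed (use le2 in simp)
    then show ?thesis by (intro magic_positive_rooted_star) auto
  next
    case 2
    have "spanning_star r UNIV ?G" for r
      unfolding spanning_star_def
    proof (intro conjI ballI)
      show "\<exists>I\<in>#?G. I \<inter> UNIV = {r, j}" if "j \<in> UNIV - {r}" for j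
        using that assms by (intro bexI[of _ "{r, j}"]) (auto simp: mem_parking_graph)
    qed (use le2 in simp_all)
    then show ?thesis using 2 by (intro magic_positive_spanning_star) auto
  next
    case 3
    obtain r s :: 'n where rs: "r \<noteq> s" "UNIV = {r, s}" using UNIV_two[OF 3(2)] .
    have "{I :: 'n set. card I = 2} = {UNIV}" using 3(2) by (metis (mono_tags, lifting) Collect_cong card_eq_UNIV_imp_eq_UNIV finite singleton_conv)
    then have "?G = repeat_mset b {#UNIV#}" by (simp add: parking_graph_def 3)
    then have "size {#I \<in># ?G. {r, s} \<subseteq> I#} = b * size {#I \<in># {#UNIV#}. {r, s} \<subseteq> I#}"
      by (simp only: size_filter_repeat_mset)
    then have "size {#I \<in># ?G. {r, s} \<subseteq> I#} = b" by simp
    then have "magic_positive 2 (\<lambda>t. real (dilate_count {r, s} ?G t))"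
      using rs 3 by (intro magic_positive_two_vertices) auto
    then show ?thesis by (simp add: 3(2) rs(2)[symmetric])
  qed
qed

theorem corollary7p12:
  fixes a b :: nat
  assumes "a > 0" and "b > 0"
  shows "real_rooted (h_star_poly (parking_polytope_ab a b :: (real ^ 'n::finite) set))"
proof -
  let ?X = "parking_polytope_ab a b :: (real ^ 'n) set"
  let ?G = "parking_graph a b :: 'n set multiset"
  let ?F = "\<lambda>t. real (dilate_count UNIV ?G t)"
  have F0: "?F 0 > 0" by (simp add: dilate_count_zero)
  have F: "?F t = real (card (lattice_points ((\<lambda>x. real t *\<^sub>R x) ` ?X)))" if "t > 0" for t
    by (simp add: card_lattice_points_parking_polytope[OF assms(1) that])
  have "CARD('n) > 0" by simp
  then consider "a > 1 \<or> CARD('n) > 2 \<or> (CARD('n) = 2 \<and> b > 1)" | "a = 1" "CARD('n) = 1"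
    | "a = 1" "b = 1" "CARD('n) = 2"
    using assms by linarith
  then show ?thesis
  proof cases
    case 1
    then have "aff_dim ?X = int CARD('n)" using assms by (intro aff_dim_parking_polytope) auto
    then have "CARD('n) = nat (aff_dim ?X)" by simp
    then show ?thesis
      using real_rooted_h_star_poly_if_magic_positive[OF _ magic_positive_parking_graph[OF assms 1] F0 F] by simp
  next
    case 2
    \<comment> \<open>The graph has no summands and the polytope is a point, so magic positivity is
      required in degree 0, where the constant 1 has it.\<close>
    have card1: "card S \<le> 1" for S :: "'n set" using card_mono[of UNIV S] 2(2) by simp
    have "?X = {\<chi> i. 1}"
    proof -
      have "incidence ?G S = 0" for S
        unfolding incidence_parking_graph using 2 by simp
      then have "?X = {x. (\<forall>i. 1 \<le> x $ i) \<and> (\<forall>S. (\<Sum>i\<in>S. x $ i - 1) \<le> 0)}"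
        unfolding parking_polytope_eq_inequalities[OF assms(1)] parking_inequalities_def by simp
      also have "\<dots> = {\<chi> i. 1}"
      proof (intro equalityI subsetI)
        fix x :: "real ^ 'n" assume "x \<in> {x. (\<forall>i. 1 \<le> x $ i) \<and> (\<forall>S. (\<Sum>i\<in>S. x $ i - 1) \<le> 0)}"
        then have "1 \<le> x $ i" "(\<Sum>i\<in>{i}. x $ i - 1) \<le> 0" for i by blast+
        then have "x $ i = 1" for i by (simp add: order_antisym)
        then show "x \<in> {\<chi> i. 1}" by (simp add: vec_eq_iff)
      qed auto
      finally show ?thesis .
    qed
    then have "0 = nat (aff_dim ?X)" by simp
    moreover have "?F = (\<lambda>t. 1)"
    proof
      fix t
      have "I \<inter> UNIV = {}" if "I \<in># ?G" for I using that 2 card1[of I] by (auto simp: mem_parking_graph)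
      then show "?F t = 1" by (simp add: dilate_count_no_edges)
    qed
    then have "magic_positive 0 ?F" using magic_positive_one by simp
    ultimately show ?thesis using real_rooted_h_star_poly_if_magic_positive[OF _ _ F0 F] by blast
  next
    case 3
    \<comment> \<open>The polytope is a unimodular triangle. Its count is the binomial of t + 2 over
      2, so h* = 1 is verified directly, without magic positivity.\<close>
    obtain r s :: 'n where rs: "r \<noteq> s" "UNIV = {r, s}" using UNIV_two[OF 3(3)] .
    have "{I :: 'n set. card I = 2} = {UNIV}" using 3(3) by (metis (mono_tags, lifting) Collect_cong card_eq_UNIV_imp_eq_UNIV finite singleton_conv)
    then have G: "?G = {#UNIV#}" by (simp add: parking_graph_def 3)
    have "aff_dim ?X = int CARD('n)" using assms 3 by (intro aff_dim_parking_polytope) auto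
    then have "2 = nat (aff_dim ?X)" using 3 by simp
    then have "h_star_poly ?X = 1"
    proof (rule h_star_poly_eqI)
      fix t :: nat assume t: "t > 0"
      have "binomial_expansion 2 1 (real t) = real ((t + 2) choose 2)"
        unfolding binomial_expansion_nat by (simp add: numeral_2_eq_2)
      also have "(t + 2) choose 2 = dilate_count UNIV ?G t"
      proof -
        have "2 * dilate_count {r, s} {#UNIV#} t = (t + 1) * (t + 2)"
          by (rule dilate_count_single_edge[OF rs(1)]) auto
        then show ?thesis by (simp add: G rs(2) choose_two)
      qed
      finally show "binomial_expansion 2 1 (real t) = real (card (lattice_points ((\<lambda>x. real t *\<^sub>R x) ` ?X)))"
        by (simp add: F[OF t])
    qed simp
    then show ?thesis by (simp add: real_rooted_def)
  qed
qed

end
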